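(* Let $m\ge 1$, $X=\{x_0,x_1,\ldots,x_m\}$, let $V$ be the real vector space with basis the coordinate functions $a^i_\eta$ ($\eta\in X^*$, $1\le i\le m$), and let $H$ be the free commutative polynomial algebra with unit $\mathbf{1}$ generated by the $a^i_\eta$, graded by $\deg(\mathbf 1)=0$, $\deg(a^i_\eta)=1+\|\eta\|$. Then the algebra $H$ with the coproduct $\Delta:H\to H\otimes H$ given on generators by $$\Delta a^{l}_{\eta} := \tilde\Theta_{\eta}\big( a_{\mathrm{e}}^{l} \otimes \mathbf{1} + \mathbf{1} \otimes a_{\mathrm{e}}^{l}\big)\in (\mathbb{R}\mathbf 1\oplus V)\otimes H, \qquad \eta\in X^*,\ 1\le l\le m,$$ and extended multiplicatively to all of $H$ (with $\Delta(\mathbf 1)=\mathbf 1\otimes\mathbf 1$), is a connected graded commutative noncocommutative Hopf algebra.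
   Context: $X^*$ is the monoid of words over the alphabet $X$, including the empty word $\mathrm{e}=\emptyset$. For $\eta\in X^*$, $\|\eta\|:=2|\eta|_0+|\eta|_1$, where $|\eta|_0$ is the number of occurrences of $x_0$ in $\eta$ and $|\eta|_1$ is the number of occurrences of letters $x_j$ with $j\neq 0$. The degree on $H$ is additive on products: $\deg(a^k_\eta a^l_\kappa)=\deg(a^k_\eta)+\deg(a^l_\kappa)$. The symbols $a^i_\eta$ are treated as algebraically independent (they are the coordinate functions $a^i_\eta(c)=(c_i,\eta)$ extracting the coefficient of $\eta$ in the $i$-th component of an $\mathbb{R}^m$-valued formal power series $c$). The counit is the algebra map with $\epsilon(\mathbf 1)=1$ and $\epsilon(a^i_\eta)=0$. For $0\le j\le m$, the right-shift map $\tilde\theta_j:H\to H$ is the derivation of $H$ with $\tilde\theta_j a^k_\eta=a^k_{\eta x_j}$ and $\tilde\theta_j\mathbf 1=0$. For $1\le j\le m$, $A^{(j)}_{\mathrm{e}}:H\to H$ is multiplication by $a^j_{\mathrm{e}}$. For $0\le i\le m$ define on $H\otimes H$ $$\tilde\Theta_i:=\tilde\theta_i\otimes\mathrm{id}+\mathrm{id}\otimes\tilde\theta_i+\delta_{0i}\sum_{j=1}^m\tilde\theta_j\otimes A^{(j)}_{\mathrm{e}},$$ where $\delta_{0i}$ is the Kronecker delta, and for $\eta=x_{i_1}\cdots x_{i_n}$ let $\tilde\Theta_\eta:=\tilde\Theta_{i_n}\circ\cdots\circ\tilde\Theta_{i_1}$ ($\tilde\Theta_{\mathrm{e}}=\mathrm{id}$).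 A graded Hopf algebra $H=\bigoplus_{n\ge0}H_n$ is connected if $H_0=\mathbb{R}\mathbf 1$; graded means $H_pH_q\subseteq H_{p+q}$ and $\Delta(H_n)\subseteq\bigoplus_{p+q=n}H_p\otimes H_q$. *)

theory Defs
  imports "HOL-Analysis.Analysis" "HOL-Analysis.Finite_Function_Topology"
begin

section \<open>Real algebras with a multiplicative basis, and their tensor products\<close>

text \<open>
  The type \<open>'b \<Rightarrow>\<^sub>0 real\<close> is the real vector space with basis \<open>'b\<close>; the basis vector belonging to
  \<open>b\<close> is \<open>Poly_Mapping.single b 1\<close>.  If \<open>'b\<close> is a monoid, it is the monoid algebra of \<open>'b\<close>.  In
  particular, \<open>('v \<Rightarrow>\<^sub>0 nat) \<Rightarrow>\<^sub>0 real\<close> is the free commutative polynomial algebra on the set of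
  generators \<open>'v\<close>.
\<close>

lemma lookup_scaleR [simp]:
  "Poly_Mapping.lookup (r *\<^sub>R p) k = r *\<^sub>R Poly_Mapping.lookup p k"
  for p :: "'a \<Rightarrow>\<^sub>0 'b::real_vector"
proof -
  have "finite {i. r *\<^sub>R Poly_Mapping.lookup p i \<noteq> 0}"
    by (rule finite_subset[OF _ finite_lookup[of p]]) auto
  then show ?thesis
    by (simp add: scaleR_poly_mapping_def)
qed

lemma scaleR_single [simp]:
  "r *\<^sub>R Poly_Mapping.single k c = Poly_Mapping.single k (r *\<^sub>R c)"
  for c :: "'b::real_vector"
  by (rule poly_mapping_eqI) (simp add: lookup_single when_def)

lemma scaleR_eq_single_mult:
  "r *\<^sub>R p = Poly_Mapping.single 0 (r *\<^sub>R 1) * p"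
  for p :: "'a::monoid_add \<Rightarrow>\<^sub>0 'b::real_algebra_1"
proof -
  have "Poly_Mapping.single 0 (r *\<^sub>R 1) * p = Poly_Mapping.map ((*) (r *\<^sub>R 1)) p"
    by (simp add: mult_map_scale_conv_mult)
  also have "\<dots> = r *\<^sub>R p"
    by (rule poly_mapping_eqI) (simp add: Poly_Mapping.map.rep_eq when_def)
  finally show ?thesis ..
qed

lemma mult_single_0_commute:
  "p * Poly_Mapping.single 0 (r *\<^sub>R 1) = Poly_Mapping.single 0 (r *\<^sub>R 1) * p"
  for p :: "'a::monoid_add \<Rightarrow>\<^sub>0 'b::real_algebra_1"
proof (induction p rule: Poly_Mapping.update_induct)
  case const
  then show ?case by simp
next
  case (update f a b)
  have "Poly_Mapping.update a b f = f + Poly_Mapping.single a b"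
    using update(1)
    by (intro poly_mapping_eqI) (auto simp: lookup_update lookup_add lookup_single when_def in_keys_iff)
  then show ?case
    using update by (simp add: distrib_left distrib_right mult_single)
qed

instance poly_mapping :: (monoid_add, real_algebra_1) real_algebra_1
proof
  fix r :: real and x y :: "'a \<Rightarrow>\<^sub>0 'b"
  show "r *\<^sub>R x * y = r *\<^sub>R (x * y)"
    unfolding scaleR_eq_single_mult[of r x] scaleR_eq_single_mult[of r "x * y"] mult.assoc ..
  show "x * r *\<^sub>R y = r *\<^sub>R (x * y)"
    unfolding scaleR_eq_single_mult[of r y] scaleR_eq_single_mult[of r "x * y"]
    by (simp only: mult_single_0_commute flip: mult.assoc)
qed

definition lin_ext :: "('b \<Rightarrow> 'c::real_vector) \<Rightarrow> ('b \<Rightarrow>\<^sub>0 real) \<Rightarrow> 'c" where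
  "lin_ext f p = (\<Sum>b\<in>Poly_Mapping.keys p. Poly_Mapping.lookup p b *\<^sub>R f b)"

lemma lin_ext_superset:
  assumes "finite S" "Poly_Mapping.keys p \<subseteq> S"
  shows "lin_ext f p = (\<Sum>b\<in>S. Poly_Mapping.lookup p b *\<^sub>R f b)"
  unfolding lin_ext_def using assms
  by (intro sum.mono_neutral_left) (auto simp: in_keys_iff)

lemma linear_lin_ext: "linear (lin_ext f)"
proof (rule linearI)
  fix p q :: "'a \<Rightarrow>\<^sub>0 real" and r :: real
  let ?S = "Poly_Mapping.keys p \<union> Poly_Mapping.keys q"
  have "lin_ext f (p + q) = (\<Sum>b\<in>?S. Poly_Mapping.lookup (p + q) b *\<^sub>R f b)"
    by (rule lin_ext_superset) (auto dest: Poly_Mapping.keys_add[THEN subsetD])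
  also have "\<dots> = (\<Sum>b\<in>?S. Poly_Mapping.lookup p b *\<^sub>R f b) + (\<Sum>b\<in>?S. Poly_Mapping.lookup q b *\<^sub>R f b)"
    by (simp add: lookup_add scaleR_add_left sum.distrib)
  also have "\<dots> = lin_ext f p + lin_ext f q"
    using lin_ext_superset[of ?S p f] lin_ext_superset[of ?S q f] by simp
  finally show "lin_ext f (p + q) = lin_ext f p + lin_ext f q" .
  have "lin_ext f (r *\<^sub>R p) = (\<Sum>b\<in>Poly_Mapping.keys p. Poly_Mapping.lookup (r *\<^sub>R p) b *\<^sub>R f b)"
    by (rule lin_ext_superset) (auto simp: in_keys_iff)
  then show "lin_ext f (r *\<^sub>R p) = r *\<^sub>R lin_ext f p"
    by (simp add: lin_ext_def scaleR_sum_right)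
qed

lemma lin_ext_single [simp]: "lin_ext f (Poly_Mapping.single b c) = c *\<^sub>R f b"
  by (cases "c = 0") (simp_all add: lin_ext_def)

lemma poly_mapping_eq_sum_single:
  "p = (\<Sum>b\<in>Poly_Mapping.keys p. Poly_Mapping.lookup p b *\<^sub>R Poly_Mapping.single b (1::real))"
  by (rule poly_mapping_eqI)
    (auto simp: lookup_sum lookup_single when_def in_keys_iff sum.delta)

lemma linear_eq_lin_ext:
  assumes "linear f"
  shows "f p = lin_ext (\<lambda>b. f (Poly_Mapping.single b 1)) p"
proof -
  have "f p = f (\<Sum>b\<in>Poly_Mapping.keys p. Poly_Mapping.lookup p b *\<^sub>R Poly_Mapping.single b (1::real))"
    using poly_mapping_eq_sum_single[of p] by simp
  also have "\<dots> = lin_ext (\<lambda>b. f (Poly_Mapping.single b 1)) p"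
    unfolding lin_ext_def linear_sum[OF assms] linear_cmul[OF assms] ..
  finally show ?thesis .
qed

lemma linear_eq_on_basis:
  assumes "linear f" "linear g"
    and "\<And>b. f (Poly_Mapping.single b (1::real)) = g (Poly_Mapping.single b 1)"
  shows "f = g"
proof
  fix p
  have "f p = lin_ext (\<lambda>b. g (Poly_Mapping.single b 1)) p"
    unfolding assms(3)[symmetric] by (rule linear_eq_lin_ext[OF assms(1)])
  then show "f p = g p"
    using linear_eq_lin_ext[OF assms(2), of p] by (rule trans[OF _ sym])
qed

lemma bilinear_eq_on_basis:
  assumes "bilinear f" "bilinear g"
    and "\<And>a b. f (Poly_Mapping.single a (1::real)) (Poly_Mapping.single b (1::real))
      = g (Poly_Mapping.single a 1) (Poly_Mapping.single b 1)"
  shows "f x y = g x y"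
proof -
  have "(\<lambda>x. f x (Poly_Mapping.single b 1)) = (\<lambda>x. g x (Poly_Mapping.single b 1))" for b
    by (rule linear_eq_on_basis) (use assms in \<open>auto simp: bilinear_def\<close>)
  then have "f x = g x" for x
    by (intro linear_eq_on_basis) (use assms in \<open>auto simp: bilinear_def fun_eq_iff\<close>)
  then show ?thesis by simp
qed

text \<open>
  The tensor product of the spaces with bases \<open>'a\<close> and \<open>'b\<close> is modelled as the space with basis
  \<open>'a \<times> 'b\<close>.  The lemmas below show that this is the tensor product in the categorical sense
  (universal property), and that the product of \<open>'a \<times> 'b \<Rightarrow>\<^sub>0 real\<close> as a monoid algebra is the usual
  product \<open>(x \<otimes> y)(x' \<otimes> y') = xx' \<otimes> yy'\<close> of a tensor product of algebras.
\<close>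

lift_definition tens :: "('a \<Rightarrow>\<^sub>0 real) \<Rightarrow> ('b \<Rightarrow>\<^sub>0 real) \<Rightarrow> ('a \<times> 'b \<Rightarrow>\<^sub>0 real)"  (infixr \<open>\<otimes>\<close> 75)
  is "\<lambda>x y (a, b). x a * y b"
proof -
  fix x :: "'a \<Rightarrow> real" and y :: "'b \<Rightarrow> real"
  assume "finite {a. x a \<noteq> 0}" "finite {b. y b \<noteq> 0}"
  then have "finite ({a. x a \<noteq> 0} \<times> {b. y b \<noteq> 0})" by simp
  then show "finite {p. (case p of (a, b) \<Rightarrow> x a * y b) \<noteq> 0}"
    by (rule rev_finite_subset) auto
qed

lemma tens_single [simp]:
  "Poly_Mapping.single a c \<otimes> Poly_Mapping.single b d = Poly_Mapping.single (a, b) (c * d)"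
  by (rule poly_mapping_eqI) (auto simp: tens.rep_eq lookup_single when_def split: if_splits)

lemma bilinear_tens: "bilinear (\<otimes>)"
  unfolding bilinear_def
  by (auto intro!: linearI poly_mapping_eqI simp: tens.rep_eq lookup_add algebra_simps)

definition tensor_lift ::
  "(('a \<Rightarrow>\<^sub>0 real) \<Rightarrow> ('b \<Rightarrow>\<^sub>0 real) \<Rightarrow> 'c::real_vector) \<Rightarrow> ('a \<times> 'b \<Rightarrow>\<^sub>0 real) \<Rightarrow> 'c" where
  "tensor_lift B = lin_ext (\<lambda>(a, b). B (Poly_Mapping.single a 1) (Poly_Mapping.single b 1))"

lemma linear_tensor_lift: "linear (tensor_lift B)"
  unfolding tensor_lift_def by (rule linear_lin_ext)

lemma tensor_lift_tens:
  assumes "bilinear B"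
  shows "tensor_lift B (x \<otimes> y) = B x y"
proof (rule bilinear_eq_on_basis[OF _ assms])
  show "bilinear (\<lambda>x y. tensor_lift B (x \<otimes> y))"
    using bilinear_tens unfolding bilinear_def
    by (auto intro!: linear_compose[OF _ linear_tensor_lift, unfolded o_def])
qed (simp add: tensor_lift_def)

lemma linear_eq_on_tens:
  assumes "linear f" "linear g" "\<And>x y. f (x \<otimes> y) = g (x \<otimes> y)"
  shows "f = g"
proof (rule linear_eq_on_basis[OF assms(1,2)])
  fix p :: "'a \<times> 'b"
  show "f (Poly_Mapping.single p 1) = g (Poly_Mapping.single p 1)"
    using assms(3)[of "Poly_Mapping.single (fst p) 1" "Poly_Mapping.single (snd p) 1"] by simp
qed

theorem tensor_universal_property:
  assumes "bilinear (B :: ('a \<Rightarrow>\<^sub>0 real) \<Rightarrow> ('b \<Rightarrow>\<^sub>0 real) \<Rightarrow> 'c::real_vector)"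
  shows "\<exists>!f. linear f \<and> (\<forall>x y. f (x \<otimes> y) = B x y)"
proof (rule ex1I[of _ "tensor_lift B"])
  fix f assume "linear f \<and> (\<forall>x y. f (x \<otimes> y) = B x y)"
  then show "f = tensor_lift B"
    by (intro linear_eq_on_tens) (auto simp: linear_tensor_lift tensor_lift_tens[OF assms])
qed (simp add: linear_tensor_lift tensor_lift_tens[OF assms])

lemma one_tens_one: "1 \<otimes> 1 = (1 :: 'a::monoid_add \<times> 'b::monoid_add \<Rightarrow>\<^sub>0 real)"
  by (simp add: zero_prod_def flip: single_one)

lemma tens_mult_tens:
  fixes x x' :: "'a::monoid_add \<Rightarrow>\<^sub>0 real" and y y' :: "'b::monoid_add \<Rightarrow>\<^sub>0 real"
  shows "(x \<otimes> y) * (x' \<otimes> y') = (x * x') \<otimes> (y * y')"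
proof -
  note bl = bilinear_ladd[OF bilinear_tens] bilinear_radd[OF bilinear_tens]
    bilinear_lmul[OF bilinear_tens] bilinear_rmul[OF bilinear_tens]
  have *: "(Poly_Mapping.single a 1 \<otimes> Poly_Mapping.single b 1) * (x' \<otimes> y')
      = (Poly_Mapping.single a 1 * x') \<otimes> (Poly_Mapping.single b 1 * y')" for a b
    by (rule bilinear_eq_on_basis
        [of "\<lambda>x' y'. (Poly_Mapping.single a 1 \<otimes> Poly_Mapping.single b 1) * (x' \<otimes> y')"])
      (auto simp: bilinear_def bl algebra_simps mult_single simp del: tens_single scaleR_single
        intro!: linearI, simp_all add: mult_single)
  show ?thesis
    by (rule bilinear_eq_on_basis[of "\<lambda>x y. (x \<otimes> y) * (x' \<otimes> y')"])
      (auto simp: bilinear_def bl algebra_simps * simp del: tens_single scaleR_single intro!: linearI)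
qed

definition tensor_map ::
  "(('a \<Rightarrow>\<^sub>0 real) \<Rightarrow> ('c \<Rightarrow>\<^sub>0 real)) \<Rightarrow> (('b \<Rightarrow>\<^sub>0 real) \<Rightarrow> ('d \<Rightarrow>\<^sub>0 real))
    \<Rightarrow> ('a \<times> 'b \<Rightarrow>\<^sub>0 real) \<Rightarrow> ('c \<times> 'd \<Rightarrow>\<^sub>0 real)" where
  "tensor_map f g = tensor_lift (\<lambda>x y. f x \<otimes> g y)"

lemma linear_tensor_map: "linear (tensor_map f g)"
  unfolding tensor_map_def by (rule linear_tensor_lift)

lemma tensor_map_tens:
  assumes "linear f" "linear g"
  shows "tensor_map f g (x \<otimes> y) = f x \<otimes> g y"
  unfolding tensor_map_def
proof (rule tensor_lift_tens)
  show "bilinear (\<lambda>x y. f x \<otimes> g y)"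
    using assms bilinear_tens unfolding bilinear_def
    by (auto intro!: linear_compose[of f, unfolded o_def] linear_compose[of g, unfolded o_def])
qed

definition tensor_flip :: "('a \<times> 'b \<Rightarrow>\<^sub>0 real) \<Rightarrow> ('b \<times> 'a \<Rightarrow>\<^sub>0 real)" where
  "tensor_flip = tensor_lift (\<lambda>x y. y \<otimes> x)"

definition tensor_assoc :: "(('a \<times> 'b) \<times> 'c \<Rightarrow>\<^sub>0 real) \<Rightarrow> ('a \<times> 'b \<times> 'c \<Rightarrow>\<^sub>0 real)" where
  "tensor_assoc = tensor_lift (\<lambda>t z. tensor_lift (\<lambda>x y. x \<otimes> y \<otimes> z) t)"

lemma tensor_flip_tens: "tensor_flip (x \<otimes> y) = y \<otimes> x"
  unfolding tensor_flip_def
  by (rule tensor_lift_tens) (use bilinear_tens in \<open>auto simp: bilinear_def\<close>)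

lemma tensor_assoc_tens: "tensor_assoc ((x \<otimes> y) \<otimes> z) = x \<otimes> y \<otimes> z"
proof -
  note bl = bilinear_ladd[OF bilinear_tens] bilinear_radd[OF bilinear_tens]
    bilinear_lmul[OF bilinear_tens] bilinear_rmul[OF bilinear_tens]
  have B: "bilinear (\<lambda>x y. x \<otimes> y \<otimes> z)" for z :: "'c \<Rightarrow>\<^sub>0 real"
    by (auto simp: bilinear_def bl intro!: linearI)
  have "linear (\<lambda>z :: 'c \<Rightarrow>\<^sub>0 real. tensor_lift (\<lambda>x y. x \<otimes> y \<otimes> z) t)" for t :: "'a \<times> 'b \<Rightarrow>\<^sub>0 real"
    by (auto simp: tensor_lift_def lin_ext_def bl sum.distrib scaleR_sum_right scaleR_add_right
        case_prod_beta mult.commute simp del: tens_single scaleR_single intro!: linearI sum.cong)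
  then have "bilinear (\<lambda>(t :: 'a \<times> 'b \<Rightarrow>\<^sub>0 real) (z :: 'c \<Rightarrow>\<^sub>0 real).
      tensor_lift (\<lambda>x y. x \<otimes> y \<otimes> z) t)"
    by (simp add: bilinear_def linear_tensor_lift)
  from tensor_lift_tens[OF this] show ?thesis
    unfolding tensor_assoc_def by (simp add: tensor_lift_tens[OF B])
qed


section \<open>Graded connected Hopf algebras\<close>

definition algebra_hom :: "('a::real_algebra_1 \<Rightarrow> 'b::real_algebra_1) \<Rightarrow> bool" where
  "algebra_hom f \<longleftrightarrow> linear f \<and> f 1 = 1 \<and> (\<forall>x y. f (x * y) = f x * f y)"

definition derivation :: "('a::real_algebra_1 \<Rightarrow> 'a) \<Rightarrow> bool" where
  "derivation D \<longleftrightarrow> linear D \<and> (\<forall>x y. D (x * y) = D x * y + x * D y)"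

text \<open>In the counit laws, \<open>\<real> \<otimes> A\<close> and \<open>A \<otimes> \<real>\<close> are identified with \<open>A\<close>.\<close>

definition coalgebra ::
  "(('b \<Rightarrow>\<^sub>0 real) \<Rightarrow> ('b \<times> 'b \<Rightarrow>\<^sub>0 real)) \<Rightarrow> (('b \<Rightarrow>\<^sub>0 real) \<Rightarrow> real) \<Rightarrow> bool" where
  "coalgebra \<Delta> \<epsilon> \<longleftrightarrow> linear \<Delta> \<and> linear \<epsilon> \<and>
    (\<forall>x. tensor_assoc (tensor_map \<Delta> id (\<Delta> x)) = tensor_map id \<Delta> (\<Delta> x)) \<and>
    (\<forall>x. tensor_lift (\<lambda>y z. \<epsilon> y *\<^sub>R z) (\<Delta> x) = x) \<and>
    (\<forall>x. tensor_lift (\<lambda>y z. \<epsilon> z *\<^sub>R y) (\<Delta> x) = x)"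

definition bialgebra ::
  "(('b::monoid_add \<Rightarrow>\<^sub>0 real) \<Rightarrow> ('b \<times> 'b \<Rightarrow>\<^sub>0 real)) \<Rightarrow> (('b \<Rightarrow>\<^sub>0 real) \<Rightarrow> real) \<Rightarrow> bool" where
  "bialgebra \<Delta> \<epsilon> \<longleftrightarrow> coalgebra \<Delta> \<epsilon> \<and> algebra_hom \<Delta> \<and> algebra_hom \<epsilon>"

definition antipode ::
  "(('b::monoid_add \<Rightarrow>\<^sub>0 real) \<Rightarrow> ('b \<times> 'b \<Rightarrow>\<^sub>0 real)) \<Rightarrow> (('b \<Rightarrow>\<^sub>0 real) \<Rightarrow> real)
    \<Rightarrow> (('b \<Rightarrow>\<^sub>0 real) \<Rightarrow> ('b \<Rightarrow>\<^sub>0 real)) \<Rightarrow> bool" where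
  "antipode \<Delta> \<epsilon> S \<longleftrightarrow> linear S \<and>
    (\<forall>x. tensor_lift (*) (tensor_map S id (\<Delta> x)) = \<epsilon> x *\<^sub>R 1) \<and>
    (\<forall>x. tensor_lift (*) (tensor_map id S (\<Delta> x)) = \<epsilon> x *\<^sub>R 1)"

definition hopf_algebra ::
  "(('b::monoid_add \<Rightarrow>\<^sub>0 real) \<Rightarrow> ('b \<times> 'b \<Rightarrow>\<^sub>0 real)) \<Rightarrow> (('b \<Rightarrow>\<^sub>0 real) \<Rightarrow> real) \<Rightarrow> bool" where
  "hopf_algebra \<Delta> \<epsilon> \<longleftrightarrow> bialgebra \<Delta> \<epsilon> \<and> (\<exists>S. antipode \<Delta> \<epsilon> S)"

definition cocommutative :: "(('b \<Rightarrow>\<^sub>0 real) \<Rightarrow> ('b \<times> 'b \<Rightarrow>\<^sub>0 real)) \<Rightarrow> bool" where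
  "cocommutative \<Delta> \<longleftrightarrow> (\<forall>x. tensor_flip (\<Delta> x) = \<Delta> x)"

text \<open>The image of \<open>U \<otimes> W\<close> in the tensor product of the ambient spaces.\<close>

definition tensor_subspace ::
  "('a \<Rightarrow>\<^sub>0 real) set \<Rightarrow> ('b \<Rightarrow>\<^sub>0 real) set \<Rightarrow> ('a \<times> 'b \<Rightarrow>\<^sub>0 real) set" where
  "tensor_subspace U W = span {x \<otimes> y | x y. x \<in> U \<and> y \<in> W}"

definition direct_sum_decomposition :: "(nat \<Rightarrow> 'a::real_vector set) \<Rightarrow> bool" where
  "direct_sum_decomposition G \<longleftrightarrow> (\<forall>n. subspace (G n)) \<and>
    (\<forall>x. \<exists>!c. (\<forall>n. c n \<in> G n) \<and> finite {n. c n \<noteq> 0} \<and> x = (\<Sum>n | c n \<noteq> 0. c n))"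

definition hopf_grading ::
  "(nat \<Rightarrow> ('b::monoid_add \<Rightarrow>\<^sub>0 real) set) \<Rightarrow> (('b \<Rightarrow>\<^sub>0 real) \<Rightarrow> ('b \<times> 'b \<Rightarrow>\<^sub>0 real)) \<Rightarrow> bool" where
  "hopf_grading G \<Delta> \<longleftrightarrow> direct_sum_decomposition G \<and>
    (\<forall>p q. \<forall>x\<in>G p. \<forall>y\<in>G q. x * y \<in> G (p + q)) \<and>
    (\<forall>n. \<forall>x\<in>G n. \<Delta> x \<in> span (\<Union>(p, q)\<in>{(p, q). p + q = n}. tensor_subspace (G p) (G q)))"

definition connected_grading :: "(nat \<Rightarrow> 'a::real_algebra_1 set) \<Rightarrow> bool" where
  "connected_grading G \<longleftrightarrow> G 0 = {c *\<^sub>R 1 | c. True}"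


section \<open>Polynomial algebras\<close>

definition gen :: "'v \<Rightarrow> ('v \<Rightarrow>\<^sub>0 nat) \<Rightarrow>\<^sub>0 real" where
  "gen v = Poly_Mapping.single (Poly_Mapping.single v 1) 1"

definition hom_ext ::
  "('v \<Rightarrow> 'c::{comm_ring_1, real_algebra_1}) \<Rightarrow> (('v \<Rightarrow>\<^sub>0 nat) \<Rightarrow>\<^sub>0 real) \<Rightarrow> 'c" where
  "hom_ext f = lin_ext (\<lambda>\<mu>. \<Prod>v\<in>Poly_Mapping.keys \<mu>. f v ^ Poly_Mapping.lookup \<mu> v)"

definition der_ext ::
  "('v \<Rightarrow> (('v \<Rightarrow>\<^sub>0 nat) \<Rightarrow>\<^sub>0 real)) \<Rightarrow> (('v \<Rightarrow>\<^sub>0 nat) \<Rightarrow>\<^sub>0 real) \<Rightarrow> (('v \<Rightarrow>\<^sub>0 nat) \<Rightarrow>\<^sub>0 real)" where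
  "der_ext f = lin_ext (\<lambda>\<mu>. \<Sum>v\<in>Poly_Mapping.keys \<mu>. real (Poly_Mapping.lookup \<mu> v) *\<^sub>R
    (Poly_Mapping.single (\<mu> - Poly_Mapping.single v 1) 1 * f v))"

lemma monomial_induct [case_names zero add]:
  fixes \<mu> :: "'v \<Rightarrow>\<^sub>0 nat"
  assumes "P 0" and step: "\<And>v \<mu>. P \<mu> \<Longrightarrow> P (Poly_Mapping.single v 1 + \<mu>)"
  shows "P \<mu>"
proof (induction "\<Sum>v\<in>Poly_Mapping.keys \<mu>. Poly_Mapping.lookup \<mu> v" arbitrary: \<mu> rule: less_induct)
  case less
  show ?case
  proof (cases "\<mu> = 0")
    case True
    then show ?thesis using assms by simp
  next
    case False
    then obtain v where v: "v \<in> Poly_Mapping.keys \<mu>"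
      by (metis keys_eq_empty ex_in_conv)
    define \<nu> where "\<nu> = \<mu> - Poly_Mapping.single v 1"
    have \<mu>: "\<mu> = Poly_Mapping.single v 1 + \<nu>"
      unfolding \<nu>_def using v
      by (intro poly_mapping_eqI) (auto simp: lookup_add lookup_minus lookup_single when_def in_keys_iff)
    have "(\<Sum>w\<in>Poly_Mapping.keys \<nu>. Poly_Mapping.lookup \<nu> w) = (\<Sum>w\<in>Poly_Mapping.keys \<mu>. Poly_Mapping.lookup \<nu> w)"
      by (rule sum.mono_neutral_left) (auto simp: \<nu>_def lookup_minus in_keys_iff)
    also have "\<dots> < (\<Sum>w\<in>Poly_Mapping.keys \<mu>. Poly_Mapping.lookup \<mu> w)"
      using v by (intro sum_strict_mono_ex1)
        (auto simp: \<nu>_def lookup_minus lookup_single in_keys_iff intro!: bexI[of _ v])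
    finally have "P \<nu>" by (rule less)
    then show ?thesis
      using step[of \<nu> v] \<mu> by simp
  qed
qed

lemma gen_mult_single:
  "gen v * Poly_Mapping.single \<mu> 1 = Poly_Mapping.single (Poly_Mapping.single v 1 + \<mu>) 1"
  by (simp add: gen_def mult_single)

lemma hom_ext_gen [simp]: "hom_ext f (gen v) = f v"
  by (simp add: hom_ext_def gen_def)

lemma algebra_hom_hom_ext: "algebra_hom (hom_ext f)"
proof -
  let ?h = "\<lambda>\<mu>. \<Prod>v\<in>Poly_Mapping.keys \<mu>. f v ^ Poly_Mapping.lookup \<mu> v"
  have lin: "linear (hom_ext f)"
    unfolding hom_ext_def by (rule linear_lin_ext)
  have h_sup: "?h \<mu> = (\<Prod>v\<in>S. f v ^ Poly_Mapping.lookup \<mu> v)"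
    if "finite S" "Poly_Mapping.keys \<mu> \<subseteq> S" for S \<mu>
    using that by (intro prod.mono_neutral_left) (auto simp: in_keys_iff)
  have h_add: "?h (\<mu> + \<nu>) = ?h \<mu> * ?h \<nu>" for \<mu> \<nu>
  proof -
    let ?S = "Poly_Mapping.keys \<mu> \<union> Poly_Mapping.keys \<nu>"
    have "?h (\<mu> + \<nu>) = (\<Prod>v\<in>?S. f v ^ Poly_Mapping.lookup (\<mu> + \<nu>) v)"
      using Poly_Mapping.keys_add[of \<mu> \<nu>] by (intro h_sup) auto
    also have "\<dots> = ?h \<mu> * ?h \<nu>"
      using h_sup[of ?S \<mu>] h_sup[of ?S \<nu>] by (simp add: lookup_add power_add prod.distrib)
    finally show ?thesis .
  qed
  have "hom_ext f (x * y) = hom_ext f x * hom_ext f y" for x y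
  proof (rule bilinear_eq_on_basis[of "\<lambda>x y. hom_ext f (x * y)"])
    show "bilinear (\<lambda>x y. hom_ext f (x * y))" "bilinear (\<lambda>x y. hom_ext f x * hom_ext f y)"
      by (auto simp: bilinear_def algebra_simps linear_add[OF lin] linear_cmul[OF lin]
          intro!: linearI)
    show "hom_ext f (Poly_Mapping.single a 1 * Poly_Mapping.single b 1)
        = hom_ext f (Poly_Mapping.single a 1) * hom_ext f (Poly_Mapping.single b 1)" for a b
      by (simp add: mult_single hom_ext_def h_add)
  qed
  moreover have "hom_ext f 1 = 1"
    by (simp add: hom_ext_def flip: single_one)
  ultimately show ?thesis
    using lin by (simp add: algebra_hom_def)
qed

lemma algebra_hom_eq_on_gen:
  assumes "algebra_hom f" "algebra_hom g" "\<And>v. f (gen v) = g (gen v)"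
  shows "f = g"
proof (rule linear_eq_on_basis)
  show "f (Poly_Mapping.single \<mu> 1) = g (Poly_Mapping.single \<mu> 1)" for \<mu>
  proof (induction \<mu> rule: monomial_induct)
    case zero
    show ?case using assms by (simp add: algebra_hom_def)
  next
    case (add v \<mu>)
    then show ?case
      unfolding gen_mult_single[symmetric] using assms by (simp add: algebra_hom_def)
  qed
qed (use assms in \<open>auto simp: algebra_hom_def\<close>)

lemma der_ext_gen [simp]: "der_ext f (gen v) = f v"
  by (simp add: der_ext_def gen_def)

lemma derivation_der_ext: "derivation (der_ext f)"
proof -
  let ?d = "\<lambda>\<mu>. \<Sum>v\<in>Poly_Mapping.keys \<mu>. real (Poly_Mapping.lookup \<mu> v) *\<^sub>R
    (Poly_Mapping.single (\<mu> - Poly_Mapping.single v 1) 1 * f v)"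
  have lin: "linear (der_ext f)"
    unfolding der_ext_def by (rule linear_lin_ext)
  have d_sup: "?d \<mu> = (\<Sum>v\<in>S. real (Poly_Mapping.lookup \<mu> v) *\<^sub>R
    (Poly_Mapping.single (\<mu> - Poly_Mapping.single v 1) 1 * f v))"
    if "finite S" "Poly_Mapping.keys \<mu> \<subseteq> S" for S \<mu>
    using that by (intro sum.mono_neutral_left) (auto simp: in_keys_iff)
  have shift: "real (Poly_Mapping.lookup \<mu> v) *\<^sub>R
      (Poly_Mapping.single (\<mu> + \<nu> - Poly_Mapping.single v 1) 1 * f v)
    = real (Poly_Mapping.lookup \<mu> v) *\<^sub>R
      (Poly_Mapping.single (\<mu> - Poly_Mapping.single v 1) 1 * f v) * Poly_Mapping.single \<nu> 1" for \<mu> \<nu> v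
  proof (cases "Poly_Mapping.lookup \<mu> v = 0")
    case False
    then have "\<mu> + \<nu> - Poly_Mapping.single v 1 = (\<mu> - Poly_Mapping.single v 1) + \<nu>"
      by (intro poly_mapping_eqI) (auto simp: lookup_add lookup_minus lookup_single when_def)
    then have "Poly_Mapping.single (\<mu> + \<nu> - Poly_Mapping.single v 1) (1::real)
      = Poly_Mapping.single (\<mu> - Poly_Mapping.single v 1) 1 * Poly_Mapping.single \<nu> 1"
      by (simp add: mult_single)
    then show ?thesis by (simp add: ac_simps)
  qed simp
  have d_add: "?d (\<mu> + \<nu>) = ?d \<mu> * Poly_Mapping.single \<nu> 1 + Poly_Mapping.single \<mu> 1 * ?d \<nu>" for \<mu> \<nu>
  proof -
    let ?S = "Poly_Mapping.keys \<mu> \<union> Poly_Mapping.keys \<nu>"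
    have "?d (\<mu> + \<nu>) = (\<Sum>v\<in>?S. real (Poly_Mapping.lookup (\<mu> + \<nu>) v) *\<^sub>R
        (Poly_Mapping.single (\<mu> + \<nu> - Poly_Mapping.single v 1) 1 * f v))"
      using Poly_Mapping.keys_add[of \<mu> \<nu>] by (intro d_sup) auto
    also have "\<dots> = (\<Sum>v\<in>?S. real (Poly_Mapping.lookup \<mu> v) *\<^sub>R
        (Poly_Mapping.single (\<mu> - Poly_Mapping.single v 1) 1 * f v) * Poly_Mapping.single \<nu> 1)
      + (\<Sum>v\<in>?S. real (Poly_Mapping.lookup \<nu> v) *\<^sub>R
        (Poly_Mapping.single (\<nu> - Poly_Mapping.single v 1) 1 * f v) * Poly_Mapping.single \<mu> 1)"
      unfolding sum.distrib[symmetric]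
    proof (rule sum.cong[OF refl])
      fix v
      show "real (Poly_Mapping.lookup (\<mu> + \<nu>) v) *\<^sub>R
          (Poly_Mapping.single (\<mu> + \<nu> - Poly_Mapping.single v 1) 1 * f v)
        = real (Poly_Mapping.lookup \<mu> v) *\<^sub>R
          (Poly_Mapping.single (\<mu> - Poly_Mapping.single v 1) 1 * f v) * Poly_Mapping.single \<nu> 1
        + real (Poly_Mapping.lookup \<nu> v) *\<^sub>R
          (Poly_Mapping.single (\<nu> - Poly_Mapping.single v 1) 1 * f v) * Poly_Mapping.single \<mu> 1"
        unfolding shift[symmetric] add.commute[of \<nu> \<mu>]
        by (simp add: lookup_add scaleR_add_left)
    qed
    also have "\<dots> = ?d \<mu> * Poly_Mapping.single \<nu> 1 + ?d \<nu> * Poly_Mapping.single \<mu> 1"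
      using d_sup[of ?S \<mu>] d_sup[of ?S \<nu>] by (simp add: sum_distrib_right)
    finally show ?thesis by (simp only: mult.commute)
  qed
  have "der_ext f (x * y) = der_ext f x * y + x * der_ext f y" for x y
  proof (rule bilinear_eq_on_basis[of "\<lambda>x y. der_ext f (x * y)"])
    show "bilinear (\<lambda>x y. der_ext f (x * y))" "bilinear (\<lambda>x y. der_ext f x * y + x * der_ext f y)"
      by (auto simp: bilinear_def algebra_simps linear_add[OF lin] linear_cmul[OF lin]
          intro!: linearI)
    show "der_ext f (Poly_Mapping.single a 1 * Poly_Mapping.single b 1)
        = der_ext f (Poly_Mapping.single a 1) * Poly_Mapping.single b 1
          + Poly_Mapping.single a 1 * der_ext f (Poly_Mapping.single b 1)" for a b
      using d_add[of a b] by (simp add: mult_single der_ext_def)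
  qed
  with lin show ?thesis
    by (simp add: derivation_def)
qed

lemma derivation_one: "derivation D \<Longrightarrow> D 1 = 0"
  unfolding derivation_def by (metis add_cancel_right_right mult.right_neutral mult_1)

lemma derivation_eq_on_gen:
  assumes "derivation f" "derivation g" "\<And>v. f (gen v) = g (gen v)"
  shows "f = g"
proof (rule linear_eq_on_basis)
  show "f (Poly_Mapping.single \<mu> 1) = g (Poly_Mapping.single \<mu> 1)" for \<mu>
  proof (induction \<mu> rule: monomial_induct)
    case zero
    show ?case using assms by (simp add: derivation_one)
  next
    case (add v \<mu>)
    then show ?case
      unfolding gen_mult_single[symmetric] using assms by (simp add: derivation_def)
  qed
qed (use assms in \<open>auto simp: derivation_def\<close>)


section \<open>The algebra of coordinate functions and its coproduct\<close>

text \<open>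
  The index type \<open>'m\<close> plays the role of \<open>{1, \<dots>, m}\<close>, so that \<open>m = CARD('m) \<ge> 1\<close> is arbitrary.
  The alphabet \<open>{x\<^sub>0, x\<^sub>1, \<dots>, x\<^sub>m}\<close> is \<open>'m letter\<close>, and words are lists of letters.
\<close>

datatype 'm letter = X0 | Xj 'm

type_synonym 'm word = "'m letter list"

text \<open>The generator \<open>a\<^sup>i\<^sub>\<eta>\<close> is indexed by \<open>(i, \<eta>)\<close>.\<close>

type_synonym 'm monomial = "('m \<times> 'm word) \<Rightarrow>\<^sub>0 nat"
type_synonym 'm H = "'m monomial \<Rightarrow>\<^sub>0 real"
type_synonym 'm HH = "'m monomial \<times> 'm monomial \<Rightarrow>\<^sub>0 real"

definition coord :: "'m \<Rightarrow> 'm word \<Rightarrow> 'm H" where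
  "coord i \<eta> = gen (i, \<eta>)"

definition word_norm :: "'m word \<Rightarrow> nat" where
  "word_norm \<eta> = 2 * length (filter (\<lambda>x. x = X0) \<eta>) + length (filter (\<lambda>x. x \<noteq> X0) \<eta>)"

definition monomial_deg :: "'m monomial \<Rightarrow> nat" where
  "monomial_deg \<mu> =
    (\<Sum>(i, \<eta>)\<in>Poly_Mapping.keys \<mu>. Poly_Mapping.lookup \<mu> (i, \<eta>) * (1 + word_norm \<eta>))"

lemma monomial_deg_single [simp]:
  "monomial_deg (Poly_Mapping.single (i, \<eta>) 1) = 1 + word_norm \<eta>"
  by (simp add: monomial_deg_def)

lemma monomial_deg_add: "monomial_deg (\<mu> + \<nu>) = monomial_deg \<mu> + monomial_deg \<nu>"
proof -
  let ?S = "Poly_Mapping.keys \<mu> \<union> Poly_Mapping.keys \<nu>"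
  have *: "monomial_deg \<kappa> = (\<Sum>(i, \<eta>)\<in>?S. Poly_Mapping.lookup \<kappa> (i, \<eta>) * (1 + word_norm \<eta>))"
    if "Poly_Mapping.keys \<kappa> \<subseteq> ?S" for \<kappa>
    unfolding monomial_deg_def using that
    by (intro sum.mono_neutral_left) (auto simp: in_keys_iff)
  show ?thesis
    using *[of "\<mu> + \<nu>"] *[of \<mu>] *[of \<nu>] Poly_Mapping.keys_add[of \<mu> \<nu>]
    by (simp add: lookup_add add_mult_distrib case_prod_beta sum.distrib)
qed

definition H_comp :: "nat \<Rightarrow> 'm H set" where
  "H_comp n = span {Poly_Mapping.single \<mu> 1 | \<mu>. monomial_deg \<mu> = n}"

definition coord_space :: "'m H set" where
  "coord_space = span {coord i \<eta> | i \<eta>. True}"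

definition shift :: "'m letter \<Rightarrow> 'm H \<Rightarrow> 'm H" where
  "shift x = der_ext (\<lambda>(k, \<eta>). coord k (\<eta> @ [x]))"

lemma shift_characterization:
  "derivation D \<and> (\<forall>k \<eta>. D (coord k \<eta>) = coord k (\<eta> @ [x])) \<longleftrightarrow> D = shift x"
proof
  assume D: "derivation D \<and> (\<forall>k \<eta>. D (coord k \<eta>) = coord k (\<eta> @ [x]))"
  show "D = shift x"
    unfolding shift_def
    by (rule derivation_eq_on_gen) (use D derivation_der_ext in \<open>auto simp: coord_def\<close>)
qed (auto simp: shift_def derivation_der_ext coord_def)

definition mult_coord :: "'m \<Rightarrow> 'm H \<Rightarrow> 'm H" where
  "mult_coord j h = coord j [] * h"

definition Theta :: "'m::finite letter \<Rightarrow> 'm HH \<Rightarrow> 'm HH" where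
  "Theta x t = tensor_map (shift x) id t + tensor_map id (shift x) t
    + (if x = X0 then \<Sum>j\<in>UNIV. tensor_map (shift (Xj j)) (mult_coord j) t else 0)"

text \<open>The first letter of the word acts first.\<close>

definition Theta_word :: "'m::finite word \<Rightarrow> 'm HH \<Rightarrow> 'm HH" where
  "Theta_word \<eta> = fold Theta \<eta>"

definition coproduct :: "'m::finite H \<Rightarrow> 'm HH" where
  "coproduct = hom_ext (\<lambda>(l, \<eta>). Theta_word \<eta> (coord l [] \<otimes> 1 + 1 \<otimes> coord l []))"

lemma coproduct_characterization:
  "algebra_hom D \<and> (\<forall>l \<eta>. D (coord l \<eta>) = Theta_word \<eta> (coord l [] \<otimes> 1 + 1 \<otimes> coord l []))
    \<longleftrightarrow> D = coproduct"
proof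
  assume D: "algebra_hom D \<and>
    (\<forall>l \<eta>. D (coord l \<eta>) = Theta_word \<eta> (coord l [] \<otimes> 1 + 1 \<otimes> coord l []))"
  show "D = coproduct"
    unfolding coproduct_def
    by (rule algebra_hom_eq_on_gen) (use D algebra_hom_hom_ext in \<open>auto simp: coord_def\<close>)
qed (auto simp: coproduct_def algebra_hom_hom_ext coord_def)

definition counit :: "'m H \<Rightarrow> real" where
  "counit = hom_ext (\<lambda>_. 0)"

end

theory Submission
  imports Defs
begin

text \<open>
  The whole structure is governed by how it commutes with the right shifts.  Each \<open>Theta x\<close> is a
  derivation of \<open>H \<otimes> H\<close>: its extra summand at \<open>X0\<close> is the derivation \<open>shift (Xj j) \<otimes> id\<close> multiplied by
  the element \<open>1 \<otimes> a\<^sup>j\<close>, where \<open>a\<^sup>j = coord j []\<close>.  Since \<open>coproduct\<close> is multiplicative, and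
  intertwines \<open>shift x\<close> with \<open>Theta x\<close> on the generators by construction, it does so on all of \<open>H\<close>
  (\<open>coproduct_shift\<close>).  On the other hand every generator arises from some \<open>coord l []\<close> by shifts, so two
  algebra homomorphisms from \<open>H\<close> that intertwine the shifts with the same operators agree as soon as
  they agree on the elements \<open>coord l []\<close> (\<open>shift_equivariant_hom_ext\<close>), which are primitive.  Each
  Hopf algebra axiom is an equality of algebra homomorphisms from \<open>H\<close>, so it only remains to find,
  for each axiom, the operators that both sides intertwine with the shifts.

  For coassociativity these are the operators \<open>Theta3 x\<close> on \<open>H \<otimes> H \<otimes> H\<close>, with the \<open>X0\<close>-part
  \<open>\<theta>\<^sub>j \<otimes> a\<^sup>j \<otimes> 1 + \<theta>\<^sub>j \<otimes> 1 \<otimes> a\<^sup>j + 1 \<otimes> \<theta>\<^sub>j \<otimes> a\<^sup>j\<close> (summed over \<open>j\<close>) besides the shifts of the three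
  factors.  For the counit laws they are the shifts themselves, because \<open>counit\<close> kills
  every shifted element.  The antipode is the algebra homomorphism with \<open>S a\<^sup>l = - a\<^sup>l\<close> that
  intertwines \<open>shift x\<close> with \<open>antipode_shift x\<close>, where at \<open>X0\<close> the latter is
  \<open>\<theta>\<^sub>0 - (\<Sum>j. a\<^sup>j \<theta>\<^sub>j)\<close>.  This correction is the one that cancels the extra summand of \<open>Theta X0\<close>:
  \<open>S * id\<close> commutes with the shifts, while \<open>id * S\<close> intertwines them with \<open>antipode_shift\<close>.  Both
  convolutions vanish on the elements \<open>coord l []\<close>, hence both equal \<open>counit\<close>.

  \<open>Theta x\<close> raises the total degree by the weight of \<open>x\<close>: at \<open>X0\<close> the weight \<open>2\<close> is shared
  between the letter \<open>x\<^sub>j\<close> appended on the left and the factor \<open>a\<^sup>j\<close> on the right.  Hence the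
  coproduct is graded.  It is not cocommutative, because
  \<open>\<Delta> a\<^sup>l\<^bsub>x\<^sub>0\<^esub>\<close> contains \<open>a\<^sup>l\<^bsub>x\<^sub>l\<^esub> \<otimes> a\<^sup>l\<close> but not the flipped term.
\<close>

section \<open>Linear maps, homomorphisms and derivations on tensor products\<close>

lemma linear_comp: "linear g \<Longrightarrow> linear f \<Longrightarrow> linear (\<lambda>x. g (f x))"
  using linear_compose[of f g] by (simp add: o_def)

lemma linear_ident: "linear (\<lambda>x. x)"
  using linear_id by (simp add: id_def)

lemma linear_tens_left: "linear f \<Longrightarrow> linear (\<lambda>x. f x \<otimes> z)"
  by (rule linear_comp[of "\<lambda>x. x \<otimes> z"]) (use bilinear_tens in \<open>auto simp: bilinear_def\<close>)

lemma linear_tens_right: "linear f \<Longrightarrow> linear (\<lambda>x. z \<otimes> f x)"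
  by (rule linear_comp[of "\<lambda>x. z \<otimes> x"]) (use bilinear_tens in \<open>auto simp: bilinear_def\<close>)

lemma linear_mult_left: "linear f \<Longrightarrow> linear (\<lambda>x. f x * c)"
  for f :: "'a::real_vector \<Rightarrow> 'b::real_algebra"
  by (rule linearI) (simp_all add: linear_add linear_cmul distrib_right)

lemma linear_mult_right: "linear f \<Longrightarrow> linear (\<lambda>x. c * f x)"
  for f :: "'a::real_vector \<Rightarrow> 'b::real_algebra"
  by (rule linearI) (simp_all add: linear_add linear_cmul distrib_left)

lemma bilinear_mult: "bilinear ((*) :: 'a::real_algebra \<Rightarrow> _)"
  unfolding bilinear_def by (intro conjI allI linear_mult_left linear_mult_right linear_ident)

lemma bilinear_mult_comp:
  fixes f :: "'a::real_algebra \<Rightarrow> 'b::real_vector"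
  assumes "linear f"
  shows "bilinear (\<lambda>x y. f (x * y))"
  unfolding bilinear_def
  by (intro conjI allI linear_comp[OF assms] linear_mult_left linear_mult_right linear_ident)

lemma bilinear_comp_mult:
  fixes f :: "'a::real_vector \<Rightarrow> 'b::real_algebra"
  assumes "linear f" "linear g"
  shows "bilinear (\<lambda>x y. f x * g y)"
  unfolding bilinear_def
  by (intro conjI allI linear_mult_left[OF assms(1)] linear_mult_right[OF assms(2)])

lemma bilinear_add: "bilinear f \<Longrightarrow> bilinear g \<Longrightarrow> bilinear (\<lambda>x y. f x y + g x y)"
  unfolding bilinear_def by (auto intro!: linear_compose_add)

lemmas tens_add_left = bilinear_ladd[OF bilinear_tens]
lemmas tens_add_right = bilinear_radd[OF bilinear_tens]
lemmas tens_zero_left [simp] = bilinear_lzero[OF bilinear_tens]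
lemmas tens_zero_right [simp] = bilinear_rzero[OF bilinear_tens]

lemma tens_sum_left: "(\<Sum>j\<in>A. f j) \<otimes> z = (\<Sum>j\<in>A. f j \<otimes> z)"
  using linear_sum[OF linear_tens_left[OF linear_ident]] .

lemma tens_sum_right: "z \<otimes> (\<Sum>j\<in>A. f j) = (\<Sum>j\<in>A. z \<otimes> f j)"
  using linear_sum[OF linear_tens_right[OF linear_ident]] .

text \<open>
  Identities between products in \<open>A \<otimes> B\<close> may be checked on pairs of pure tensors, where the product is
  explicit.  Multiplicativity and the Leibniz rule on tensor products are derived this way below.
\<close>

lemma bilinear_eq_on_tens:
  assumes "bilinear f" "bilinear g" "\<And>x y x' y'. f (x \<otimes> y) (x' \<otimes> y') = g (x \<otimes> y) (x' \<otimes> y')"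
  shows "f s t = g s t"
proof (rule bilinear_eq_on_basis[OF assms(1,2)])
  fix p :: "'a \<times> 'b" and q :: "'c \<times> 'd"
  show "f (Poly_Mapping.single p 1) (Poly_Mapping.single q 1)
      = g (Poly_Mapping.single p 1) (Poly_Mapping.single q 1)"
    using assms(3)[of "Poly_Mapping.single (fst p) 1" "Poly_Mapping.single (snd p) 1"
        "Poly_Mapping.single (fst q) 1" "Poly_Mapping.single (snd q) 1"] by simp
qed

lemma algebra_homD:
  assumes "algebra_hom f"
  shows "linear f" "f 1 = 1" "f (x * y) = f x * f y"
  using assms by (auto simp: algebra_hom_def)

lemma derivationD:
  assumes "derivation D"
  shows "linear D" "D (x * y) = D x * y + x * D y"
  using assms by (auto simp: derivation_def)

lemma algebra_hom_id: "algebra_hom id"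
  by (auto simp: algebra_hom_def intro: linear_id)

lemma algebra_hom_comp: "algebra_hom g \<Longrightarrow> algebra_hom f \<Longrightarrow> algebra_hom (\<lambda>x. g (f x))"
  by (auto simp: algebra_hom_def intro: linear_comp)

lemma algebra_hom_tensI:
  fixes f :: "('a::monoid_add \<times> 'b::monoid_add \<Rightarrow>\<^sub>0 real) \<Rightarrow> 'c::real_algebra_1"
  assumes "linear f" "f (1 \<otimes> 1) = 1"
    and "\<And>x y x' y'. f ((x * x') \<otimes> (y * y')) = f (x \<otimes> y) * f (x' \<otimes> y')"
  shows "algebra_hom f"
proof -
  have "f (s * t) = f s * f t" for s t
    by (rule bilinear_eq_on_tens
        [OF bilinear_mult_comp[OF assms(1)] bilinear_comp_mult[OF assms(1) assms(1)]])
      (simp add: tens_mult_tens assms(3))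
  then show ?thesis
    using assms(1,2) by (simp add: algebra_hom_def one_tens_one)
qed

lemma algebra_hom_tensor_map:
  assumes "algebra_hom f" "algebra_hom g"
  shows "algebra_hom (tensor_map f g)"
  by (rule algebra_hom_tensI)
    (use assms in \<open>auto simp: linear_tensor_map tensor_map_tens algebra_homD tens_mult_tens\<close>,
      simp add: one_tens_one)

lemma linear_tensor_assoc: "linear tensor_assoc"
  unfolding tensor_assoc_def by (rule linear_tensor_lift)

lemma algebra_hom_tensor_assoc:
  "algebra_hom (tensor_assoc ::
    (('a::monoid_add \<times> 'b::monoid_add) \<times> 'c::monoid_add \<Rightarrow>\<^sub>0 real) \<Rightarrow> _)"
proof (rule algebra_hom_tensI)
  show "linear (tensor_assoc :: (('a \<times> 'b) \<times> 'c \<Rightarrow>\<^sub>0 real) \<Rightarrow> _)"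
    by (rule linear_tensor_assoc)
  show "tensor_assoc ((1 :: 'a \<times> 'b \<Rightarrow>\<^sub>0 real) \<otimes> (1 :: 'c \<Rightarrow>\<^sub>0 real)) = 1"
    using tensor_assoc_tens[of "1 :: 'a \<Rightarrow>\<^sub>0 real" "1 :: 'b \<Rightarrow>\<^sub>0 real" "1 :: 'c \<Rightarrow>\<^sub>0 real"]
    by (simp add: one_tens_one)
  show "tensor_assoc ((s * s') \<otimes> (z * z')) = tensor_assoc (s \<otimes> z) * tensor_assoc (s' \<otimes> z')"
    for s s' :: "'a \<times> 'b \<Rightarrow>\<^sub>0 real" and z z' :: "'c \<Rightarrow>\<^sub>0 real"
  proof -
    have lin: "linear (\<lambda>s :: 'a \<times> 'b \<Rightarrow>\<^sub>0 real. tensor_assoc (s \<otimes> z))" for z :: "'c \<Rightarrow>\<^sub>0 real"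
      by (rule linear_comp[OF linear_tensor_assoc linear_tens_left[OF linear_ident]])
    show ?thesis
      using bilinear_eq_on_tens[OF bilinear_mult_comp[OF lin[of "z * z'"]]
          bilinear_comp_mult[OF lin[of z] lin[of z']], of s s']
      by (simp add: tens_mult_tens tensor_assoc_tens)
  qed
qed

lemma algebra_hom_tensor_lift_mult:
  "algebra_hom (tensor_lift ((*) :: ('a::comm_monoid_add \<Rightarrow>\<^sub>0 real) \<Rightarrow> _))"
  by (rule algebra_hom_tensI)
    (auto simp: linear_tensor_lift tensor_lift_tens[OF bilinear_mult] ac_simps)

lemma
  assumes "linear \<epsilon>"
  shows tensor_lift_counit_left: "tensor_lift (\<lambda>y z. \<epsilon> y *\<^sub>R z) (x \<otimes> y) = \<epsilon> x *\<^sub>R y"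
    and tensor_lift_counit_right: "tensor_lift (\<lambda>y z. \<epsilon> z *\<^sub>R y) (x \<otimes> y) = \<epsilon> y *\<^sub>R x"
  using assms
  by (auto intro!: tensor_lift_tens linearI
      simp: bilinear_def linear_add linear_cmul scaleR_add_left scaleR_add_right)

lemma
  fixes \<epsilon> :: "('a::monoid_add \<Rightarrow>\<^sub>0 real) \<Rightarrow> real"
  assumes "algebra_hom \<epsilon>"
  shows algebra_hom_counit_left: "algebra_hom (tensor_lift (\<lambda>y (z :: 'a \<Rightarrow>\<^sub>0 real). \<epsilon> y *\<^sub>R z))"
    and algebra_hom_counit_right: "algebra_hom (tensor_lift (\<lambda>(y :: 'a \<Rightarrow>\<^sub>0 real) z. \<epsilon> z *\<^sub>R y))"
  by (rule algebra_hom_tensI, auto simp: linear_tensor_lift algebra_homD[OF assms]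
      tensor_lift_counit_left[OF algebra_homD(1)[OF assms]]
      tensor_lift_counit_right[OF algebra_homD(1)[OF assms]] mult.commute)+

lemma derivation_zero: "derivation (\<lambda>_. 0)"
  by (auto simp: derivation_def intro!: linearI)

lemma derivation_add: "derivation D \<Longrightarrow> derivation E \<Longrightarrow> derivation (\<lambda>x. D x + E x)"
  by (auto simp: derivation_def algebra_simps intro!: linear_compose_add)

lemma derivation_diff: "derivation D \<Longrightarrow> derivation E \<Longrightarrow> derivation (\<lambda>x. D x - E x)"
  by (auto simp: derivation_def algebra_simps intro!: linear_compose_sub)

lemma derivation_sum:
  assumes "\<And>j. j \<in> A \<Longrightarrow> derivation (D j)"
  shows "derivation (\<lambda>x. \<Sum>j\<in>A. D j x)"
  using assms
  by (auto simp: derivation_def sum_distrib_left sum_distrib_right sum.distrib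
      intro!: linear_compose_sum)

lemma derivation_scale:
  fixes D :: "'a::{comm_ring_1, real_algebra_1} \<Rightarrow> 'a"
  shows "derivation D \<Longrightarrow> derivation (\<lambda>x. c * D x)"
  by (auto simp: derivation_def algebra_simps intro!: linear_mult_right)

lemma derivation_tensI:
  fixes D :: "('a::monoid_add \<times> 'b::monoid_add \<Rightarrow>\<^sub>0 real) \<Rightarrow> _"
  assumes "linear D"
    and "\<And>x y x' y'. D ((x * x') \<otimes> (y * y'))
      = D (x \<otimes> y) * (x' \<otimes> y') + (x \<otimes> y) * D (x' \<otimes> y')"
  shows "derivation D"
proof -
  have "D (s * t) = D s * t + s * D t" for s t
    by (rule bilinear_eq_on_tens[OF bilinear_mult_comp[OF assms(1)]
          bilinear_add[OF bilinear_comp_mult[OF assms(1) linear_ident]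
            bilinear_comp_mult[OF linear_ident assms(1)]]])
      (simp add: tens_mult_tens assms(2))
  with assms(1) show ?thesis by (simp add: derivation_def)
qed

lemma
  fixes D :: "('a::monoid_add \<Rightarrow>\<^sub>0 real) \<Rightarrow> _"
  assumes "derivation D"
  shows derivation_tensor_map_left:
      "derivation (tensor_map D (id :: ('b::monoid_add \<Rightarrow>\<^sub>0 real) \<Rightarrow> _))"
    and derivation_tensor_map_right:
      "derivation (tensor_map (id :: ('b::monoid_add \<Rightarrow>\<^sub>0 real) \<Rightarrow> _) D)"
  by (rule derivation_tensI, rule linear_tensor_map, simp add: tensor_map_tens[OF derivationD(1)[OF assms] linear_id]
        tensor_map_tens[OF linear_id derivationD(1)[OF assms]]
        derivationD(2)[OF assms] tens_mult_tens tens_add_left tens_add_right)+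

text \<open>
  With \<open>h\<close> multiplicative, \<open>h \<circ> D\<close> and \<open>E \<circ> h\<close> are both derivations along \<open>h\<close>: each sends \<open>x * y\<close> to
  \<open>F x * h y + h x * F y\<close>.  Such a map is determined by its values on the generators.
\<close>

lemma hom_intertwines_derivations:
  assumes h: "algebra_hom h" and D: "derivation D" and E: "derivation E"
    and gen: "\<And>v. h (D (gen v)) = E (h (gen v))"
  shows "h (D x) = E (h x)"
proof -
  have "(\<lambda>x. h (D x)) = (\<lambda>x. E (h x))"
  proof (rule linear_eq_on_basis)
    show "linear (\<lambda>x. h (D x))" "linear (\<lambda>x. E (h x))"
      using linear_comp[OF algebra_homD(1)[OF h] derivationD(1)[OF D]]
        linear_comp[OF derivationD(1)[OF E] algebra_homD(1)[OF h]] .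
    show "h (D (Poly_Mapping.single \<mu> 1)) = E (h (Poly_Mapping.single \<mu> 1))" for \<mu>
    proof (induction \<mu> rule: monomial_induct)
      case zero
      show ?case
        using linear_0[OF algebra_homD(1)[OF h]]
        by (simp add: derivation_one[OF D] derivation_one[OF E] algebra_homD[OF h])
    next
      case (add v \<mu>)
      then show ?case
        unfolding gen_mult_single[symmetric]
        by (simp add: algebra_homD[OF h] derivationD(2)[OF D] derivationD(2)[OF E]
            linear_add[OF algebra_homD(1)[OF h]] gen)
    qed
  qed
  then show ?thesis by (rule fun_cong)
qed

section \<open>Shifts and the coproduct\<close>

lemma shift_coord [simp]: "shift x (coord l \<eta>) = coord l (\<eta> @ [x])"
  by (simp add: shift_def coord_def)

lemma derivation_shift: "derivation (shift x)"
  unfolding shift_def by (rule derivation_der_ext)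

lemmas linear_shift = derivationD(1)[OF derivation_shift]
lemmas shift_mult = derivationD(2)[OF derivation_shift]

text \<open>
  The uniqueness principle behind every Hopf algebra axiom.  Since \<open>coord l \<eta>\<close> is obtained from
  \<open>coord l []\<close> by appending the letters of \<open>\<eta>\<close> through shifts, equivariance propagates agreement from
  the empty word to all words.  The operators \<open>E x\<close> are chosen to suit each axiom.
\<close>

lemma shift_equivariant_hom_ext:
  fixes f g :: "'m H \<Rightarrow> 'c::real_algebra_1"
  assumes "algebra_hom f" "algebra_hom g"
    and "\<And>l. f (coord l []) = g (coord l [])"
    and "\<And>x h. f (shift x h) = E x (f h)" "\<And>x h. g (shift x h) = E x (g h)"
  shows "f = g"
proof (rule algebra_hom_eq_on_gen[OF assms(1,2)])
  have "f (coord l \<eta>) = g (coord l \<eta>)" for l \<eta>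
  proof (induction \<eta> rule: rev_induct)
    case Nil
    show ?case by (rule assms)
  next
    case (snoc x \<eta>)
    then show ?case
      using assms(4,5)[of x "coord l \<eta>"] by simp
  qed
  then show "f (gen v) = g (gen v)" for v
    by (cases v) (simp add: coord_def)
qed

text \<open>
  The companion existence principle: prescribing the values on \<open>coord l []\<close> and iterating derivations
  along the words gives an equivariant homomorphism.  Both the coproduct and the antipode have this form.
\<close>

lemma shift_equivariant_hom_word:
  fixes E :: "'m letter \<Rightarrow> 'c::{comm_ring_1, real_algebra_1} \<Rightarrow> 'c"
    and c :: "'m \<Rightarrow> 'c"
  assumes "\<And>x. derivation (E x)"
  shows "hom_ext (\<lambda>(l, \<eta>). fold E \<eta> (c l)) (shift x y)
    = E x (hom_ext (\<lambda>(l, \<eta>). fold E \<eta> (c l)) y)"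
proof -
  let ?h = "hom_ext (\<lambda>(l, \<eta>). fold E \<eta> (c l))"
  have "?h (shift x (gen v)) = E x (?h (gen v))" for v
  proof (cases v)
    case (Pair l \<eta>)
    have "shift x (gen (l, \<eta>)) = gen (l, \<eta> @ [x])"
      using shift_coord[of x l \<eta>] by (simp only: coord_def)
    then show ?thesis
      by (simp add: Pair)
  qed
  from hom_intertwines_derivations[OF algebra_hom_hom_ext derivation_shift assms this]
  show ?thesis .
qed

lemma linear_mult_coord: "linear (mult_coord j)"
  unfolding mult_coord_def[abs_def] by (rule linear_mult_right[OF linear_ident])

lemma Theta_tens:
  "Theta x (y \<otimes> z) = shift x y \<otimes> z + y \<otimes> shift x z
    + (if x = X0 then \<Sum>j\<in>UNIV. shift (Xj j) y \<otimes> (coord j [] * z) else 0)"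
  by (simp add: Theta_def tensor_map_tens linear_shift linear_id linear_mult_coord mult_coord_def)

text \<open>
  The twist \<open>shift y \<otimes> mult_coord j\<close> is \<open>shift y \<otimes> id\<close> followed by multiplication by \<open>1 \<otimes> coord j []\<close>,
  and in a commutative algebra a multiple of a derivation is again a derivation.
\<close>

lemma derivation_Theta: "derivation (Theta x)"
proof -
  have *: "tensor_map (shift y) (mult_coord j) = (\<lambda>t. (1 \<otimes> coord j []) * tensor_map (shift y) id t)"
    for y :: "'a letter" and j
    by (rule linear_eq_on_tens)
      (simp_all add: linear_mult_right linear_tensor_map tensor_map_tens linear_shift linear_id linear_mult_coord
          mult_coord_def tens_mult_tens)
  note d = derivation_tensor_map_left[OF derivation_shift]
    derivation_tensor_map_right[OF derivation_shift]
  show ?thesis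
    unfolding Theta_def[abs_def] *
    by (cases "x = X0") (auto intro!: derivation_add derivation_sum derivation_scale d)
qed

lemmas linear_Theta = derivationD(1)[OF derivation_Theta]

lemma coproduct_coord: "coproduct (coord l \<eta>) = Theta_word \<eta> (coord l [] \<otimes> 1 + 1 \<otimes> coord l [])"
  by (simp add: coproduct_def coord_def)

lemma coproduct_coord_Nil [simp]: "coproduct (coord l []) = coord l [] \<otimes> 1 + 1 \<otimes> coord l []"
  by (simp add: coproduct_coord Theta_word_def)

lemma algebra_hom_coproduct: "algebra_hom coproduct"
  unfolding coproduct_def by (rule algebra_hom_hom_ext)

lemmas linear_coproduct = algebra_homD(1)[OF algebra_hom_coproduct]

lemma coproduct_shift: "coproduct (shift x h) = Theta x (coproduct h)"
  unfolding coproduct_def Theta_word_def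
  by (rule shift_equivariant_hom_word[OF derivation_Theta])

section \<open>Coassociativity\<close>

text \<open>
  \<open>Theta x\<close> with its second tensor factor \<open>H\<close> replaced by \<open>H \<otimes> H\<close>, on which \<open>x\<close> acts by \<open>Theta x\<close>
  and \<open>coord j []\<close> acts through its coproduct.  This form makes the equivariance of
  \<open>(id \<otimes> \<Delta>) \<circ> \<Delta>\<close> immediate.
\<close>

definition Theta3 ::
  "'m::finite letter \<Rightarrow> ('m monomial \<times> 'm monomial \<times> 'm monomial \<Rightarrow>\<^sub>0 real)
    \<Rightarrow> ('m monomial \<times> 'm monomial \<times> 'm monomial \<Rightarrow>\<^sub>0 real)" where
  "Theta3 x t = tensor_map (shift x) id t + tensor_map id (Theta x) t
    + (if x = X0 then \<Sum>j\<in>UNIV. tensor_map (shift (Xj j)) ((*) (coproduct (coord j []))) t else 0)"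

lemma Theta3_tens:
  "Theta3 x (y \<otimes> t) = shift x y \<otimes> t + y \<otimes> Theta x t
    + (if x = X0 then \<Sum>j\<in>UNIV. shift (Xj j) y \<otimes> (coproduct (coord j []) * t) else 0)"
  by (simp add: Theta3_def tensor_map_tens linear_shift linear_id linear_Theta
      linear_mult_right[OF linear_ident])

lemma linear_Theta3: "linear (Theta3 x)"
  unfolding Theta3_def[abs_def]
  by (cases "x = X0") (auto intro!: linear_compose_add linear_compose_sum linear_tensor_map
      simp: module_hom_zero)

lemma coproduct_right_Theta: "tensor_map id coproduct (Theta x t) = Theta3 x (tensor_map id coproduct t)"
proof -
  have "(\<lambda>t. tensor_map id coproduct (Theta x t)) = (\<lambda>t. Theta3 x (tensor_map id coproduct t))"
  proof (rule linear_eq_on_tens)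
    show "linear (\<lambda>t. tensor_map id coproduct (Theta x t))"
      "linear (\<lambda>t. Theta3 x (tensor_map id coproduct t))"
      by (rule linear_comp[OF linear_tensor_map linear_Theta]
          linear_comp[OF linear_Theta3 linear_tensor_map])+
    show "tensor_map id coproduct (Theta x (y \<otimes> z)) = Theta3 x (tensor_map id coproduct (y \<otimes> z))"
      for y z
      by (simp add: Theta_tens Theta3_tens tensor_map_tens linear_id linear_coproduct
          coproduct_shift linear_add[OF linear_tensor_map] linear_sum[OF linear_tensor_map]
          linear_0[OF linear_tensor_map] algebra_homD(3)[OF algebra_hom_coproduct])
  qed
  then show ?thesis by (rule fun_cong)
qed

text \<open>
  The same operator \<open>Theta3 x\<close> also comes from bracketing to the left: both bracketings
  contribute \<open>\<theta>\<^sub>j \<otimes> a\<^sup>j \<otimes> 1 + \<theta>\<^sub>j \<otimes> 1 \<otimes> a\<^sup>j + 1 \<otimes> \<theta>\<^sub>j \<otimes> a\<^sup>j\<close>.  On the right the first two terms come from the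
  primitivity of \<open>a\<^sup>j\<close>; on the left the last two come from applying \<open>Theta (Xj j)\<close> to the first two factors.
  The first two factors are a general element \<open>s\<close>, since the coproduct is not a pure tensor.
\<close>

lemma tensor_assoc_Theta:
  "tensor_assoc (Theta x s \<otimes> z + s \<otimes> shift x z
      + (if x = X0 then \<Sum>j\<in>UNIV. Theta (Xj j) s \<otimes> (coord j [] * z) else 0))
    = Theta3 x (tensor_assoc (s \<otimes> z))"
proof -
  have "(\<lambda>s. tensor_assoc (Theta x s \<otimes> z + s \<otimes> shift x z
      + (if x = X0 then \<Sum>j\<in>UNIV. Theta (Xj j) s \<otimes> (coord j [] * z) else 0)))
    = (\<lambda>s. Theta3 x (tensor_assoc (s \<otimes> z)))"
  proof (rule linear_eq_on_tens)
    show "linear (\<lambda>s. tensor_assoc (Theta x s \<otimes> z + s \<otimes> shift x z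
      + (if x = X0 then \<Sum>j\<in>UNIV. Theta (Xj j) s \<otimes> (coord j [] * z) else 0)))"
      by (cases "x = X0")
        (auto intro!: linear_comp[OF linear_tensor_assoc] linear_compose_add linear_compose_sum
          linear_tens_left linear_Theta linear_ident simp: module_hom_zero)
    show "linear (\<lambda>s. Theta3 x (tensor_assoc (s \<otimes> z)))"
      by (intro linear_comp[OF linear_Theta3] linear_comp[OF linear_tensor_assoc]
          linear_tens_left linear_ident)
    fix u v
    show "tensor_assoc (Theta x (u \<otimes> v) \<otimes> z + (u \<otimes> v) \<otimes> shift x z
      + (if x = X0 then \<Sum>j\<in>UNIV. Theta (Xj j) (u \<otimes> v) \<otimes> (coord j [] * z) else 0))
      = Theta3 x (tensor_assoc ((u \<otimes> v) \<otimes> z))"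
      by (simp add: Theta_tens Theta3_tens tens_add_left tens_add_right tens_sum_left
          tens_sum_right tensor_assoc_tens linear_add[OF linear_tensor_assoc]
          linear_sum[OF linear_tensor_assoc] linear_0[OF linear_tensor_assoc] sum.distrib tens_mult_tens distrib_right)
  qed
  then show ?thesis by (rule fun_cong)
qed

lemma coproduct_left_Theta:
  "tensor_assoc (tensor_map coproduct id (Theta x t))
    = Theta3 x (tensor_assoc (tensor_map coproduct id t))"
proof -
  have "(\<lambda>t. tensor_assoc (tensor_map coproduct id (Theta x t)))
      = (\<lambda>t. Theta3 x (tensor_assoc (tensor_map coproduct id t)))"
  proof (rule linear_eq_on_tens)
    show "linear (\<lambda>t. tensor_assoc (tensor_map coproduct id (Theta x t)))"
      by (intro linear_comp[OF linear_tensor_assoc] linear_comp[OF linear_tensor_map] linear_Theta)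
    show "linear (\<lambda>t. Theta3 x (tensor_assoc (tensor_map coproduct id t)))"
      by (intro linear_comp[OF linear_tensor_assoc] linear_comp[OF linear_Theta3] linear_tensor_map)
    show "tensor_assoc (tensor_map coproduct id (Theta x (y \<otimes> z)))
      = Theta3 x (tensor_assoc (tensor_map coproduct id (y \<otimes> z)))" for y z
      using tensor_assoc_Theta[of x "coproduct y" z]
      by (simp add: Theta_tens tensor_map_tens linear_id linear_coproduct coproduct_shift
          linear_add[OF linear_tensor_map] linear_sum[OF linear_tensor_map] if_distrib cong: if_cong)
  qed
  then show ?thesis by (rule fun_cong)
qed

lemma coproduct_coassociative:
  "tensor_assoc (tensor_map coproduct id (coproduct h)) = tensor_map id coproduct (coproduct h)"
proof -
  have "(\<lambda>h. tensor_assoc (tensor_map coproduct id (coproduct h)))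
      = (\<lambda>h. tensor_map id coproduct (coproduct h))"
  proof (rule shift_equivariant_hom_ext)
    show "algebra_hom (\<lambda>h. tensor_assoc (tensor_map coproduct id (coproduct h)))"
      "algebra_hom (\<lambda>h. tensor_map id coproduct (coproduct h))"
      by (intro algebra_hom_comp[OF algebra_hom_tensor_assoc] algebra_hom_comp[OF algebra_hom_tensor_map]
          algebra_hom_coproduct algebra_hom_id)+
    show "tensor_assoc (tensor_map coproduct id (coproduct (coord l [])))
        = tensor_map id coproduct (coproduct (coord l []))" for l
      by (simp add: tensor_map_tens linear_id linear_coproduct linear_add[OF linear_tensor_map]
          algebra_homD(2)[OF algebra_hom_coproduct] tens_add_left tens_add_right
          linear_add[OF linear_tensor_assoc] tensor_assoc_tens flip: one_tens_one)
  qed (simp_all only: coproduct_shift coproduct_left_Theta coproduct_right_Theta)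
  then show ?thesis by (rule fun_cong)
qed

section \<open>The counit\<close>

lemma algebra_hom_counit: "algebra_hom counit"
  unfolding counit_def by (rule algebra_hom_hom_ext)

lemmas linear_counit = algebra_homD(1)[OF algebra_hom_counit]

lemma counit_coord [simp]: "counit (coord l \<eta>) = 0"
  by (simp add: counit_def coord_def)

text \<open>
  The zero map is a derivation of \<open>\<real>\<close>, so the values on generators decide.
\<close>

lemma counit_shift [simp]: "counit (shift x h) = 0"
proof (rule hom_intertwines_derivations[of counit "shift x" "\<lambda>_. 0"])
  show "counit (shift x (gen v)) = 0" for v
    using shift_coord[of x "fst v" "snd v"] counit_coord[of "fst v" "snd v @ [x]"]
    by (simp add: coord_def)
qed (auto simp: algebra_hom_counit derivation_shift derivation_zero)

lemma counit_left: "tensor_lift (\<lambda>y z. counit y *\<^sub>R z) (coproduct h) = h"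
proof -
  let ?c = "tensor_lift (\<lambda>y z :: 'a H. counit y *\<^sub>R z)"
  have c_Theta: "?c (Theta x t) = shift x (?c t)" for x t
  proof -
    have "(\<lambda>t. ?c (Theta x t)) = (\<lambda>t. shift x (?c t))"
    proof (rule linear_eq_on_tens)
      show "linear (\<lambda>t. ?c (Theta x t))" "linear (\<lambda>t. shift x (?c t))"
        by (rule linear_comp[OF linear_tensor_lift linear_Theta]
            linear_comp[OF linear_shift linear_tensor_lift])+
      show "?c (Theta x (y \<otimes> z)) = shift x (?c (y \<otimes> z))" for y z
        unfolding Theta_tens
        by (simp add: linear_add[OF linear_tensor_lift] linear_sum[OF linear_tensor_lift]
            linear_0[OF linear_tensor_lift] tensor_lift_counit_left[OF linear_counit]
            linear_cmul[OF linear_shift])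
    qed
    then show ?thesis by (rule fun_cong)
  qed
  have "(\<lambda>h. ?c (coproduct h)) = (\<lambda>h. h)"
  proof (rule shift_equivariant_hom_ext[of _ _ shift])
    show "algebra_hom (\<lambda>h. ?c (coproduct h))" "algebra_hom (\<lambda>h :: 'a H. h)"
      using algebra_hom_comp[OF algebra_hom_counit_left[OF algebra_hom_counit] algebra_hom_coproduct]
        algebra_hom_id by (auto simp: id_def)
  qed (simp_all add: coproduct_shift c_Theta linear_add[OF linear_tensor_lift]
      tensor_lift_counit_left[OF linear_counit] algebra_homD[OF algebra_hom_counit])
  then show ?thesis by (rule fun_cong)
qed

lemma counit_right: "tensor_lift (\<lambda>y z. counit z *\<^sub>R y) (coproduct h) = h"
proof -
  let ?c = "tensor_lift (\<lambda>(y :: 'a H) z. counit z *\<^sub>R y)"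
  have c_Theta: "?c (Theta x t) = shift x (?c t)" for x t
  proof -
    have "(\<lambda>t. ?c (Theta x t)) = (\<lambda>t. shift x (?c t))"
    proof (rule linear_eq_on_tens)
      show "linear (\<lambda>t. ?c (Theta x t))" "linear (\<lambda>t. shift x (?c t))"
        by (rule linear_comp[OF linear_tensor_lift linear_Theta]
            linear_comp[OF linear_shift linear_tensor_lift])+
      show "?c (Theta x (y \<otimes> z)) = shift x (?c (y \<otimes> z))" for y z
        unfolding Theta_tens
        by (simp add: linear_add[OF linear_tensor_lift] linear_sum[OF linear_tensor_lift]
            linear_0[OF linear_tensor_lift] tensor_lift_counit_right[OF linear_counit]
            linear_cmul[OF linear_shift]
            algebra_homD[OF algebra_hom_counit])
    qed
    then show ?thesis by (rule fun_cong)
  qed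
  have "(\<lambda>h. ?c (coproduct h)) = (\<lambda>h. h)"
  proof (rule shift_equivariant_hom_ext[of _ _ shift])
    show "algebra_hom (\<lambda>h. ?c (coproduct h))" "algebra_hom (\<lambda>h :: 'a H. h)"
      using algebra_hom_comp[OF algebra_hom_counit_right[OF algebra_hom_counit] algebra_hom_coproduct]
        algebra_hom_id by (auto simp: id_def)
  qed (simp_all add: coproduct_shift c_Theta linear_add[OF linear_tensor_lift]
      tensor_lift_counit_right[OF linear_counit] algebra_homD[OF algebra_hom_counit])
  then show ?thesis by (rule fun_cong)
qed

section \<open>The antipode\<close>

text \<open>
  Solving \<open>(S * id) \<circ> shift x = shift x \<circ> (S * id)\<close> for the operator that replaces \<open>shift x\<close> after \<open>S\<close> gives
  this formula: the extra summand \<open>\<theta>\<^sub>j \<otimes> a\<^sup>j\<close> of \<open>Theta X0\<close> contributes \<open>\<theta>\<^sub>j (S y) * a\<^sup>j * z\<close>, which has to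
  be subtracted again.
\<close>

definition antipode_shift :: "'m::finite letter \<Rightarrow> 'm H \<Rightarrow> 'm H" where
  "antipode_shift x h =
    shift x h - (if x = X0 then \<Sum>j\<in>UNIV. coord j [] * shift (Xj j) h else 0)"

definition antipode_map :: "'m::finite H \<Rightarrow> 'm H" where
  "antipode_map = hom_ext (\<lambda>(l, \<eta>). fold antipode_shift \<eta> (- coord l []))"

lemma derivation_antipode_shift: "derivation (antipode_shift x)"
  unfolding antipode_shift_def[abs_def]
  by (cases "x = X0")
    (auto intro!: derivation_diff derivation_sum derivation_scale derivation_shift derivation_zero)

lemma algebra_hom_antipode_map: "algebra_hom antipode_map"
  unfolding antipode_map_def by (rule algebra_hom_hom_ext)

lemmas linear_antipode_map = algebra_homD(1)[OF algebra_hom_antipode_map]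

lemma antipode_map_coord_Nil [simp]: "antipode_map (coord l []) = - coord l []"
  by (simp add: antipode_map_def coord_def)

lemma antipode_map_shift: "antipode_map (shift x h) = antipode_shift x (antipode_map h)"
  unfolding antipode_map_def by (rule shift_equivariant_hom_word[OF derivation_antipode_shift])

lemma algebra_hom_counit_scale: "algebra_hom (\<lambda>h :: 'm H. counit h *\<^sub>R (1 :: 'm H))"
  by (auto simp: algebra_hom_def algebra_homD[OF algebra_hom_counit] linear_add[OF linear_counit]
      linear_cmul[OF linear_counit] scaleR_add_left mult.commute intro!: linearI
      simp del: scaleR_single)

text \<open>
  \<open>S * id\<close> and \<open>counit\<close> are shift-equivariant homomorphisms (the former because \<open>H\<close> is commutative),
  and both vanish on the primitive elements \<open>coord l []\<close>.
\<close>

lemma antipode_left: "tensor_lift (*) (tensor_map antipode_map id (coproduct h)) = counit h *\<^sub>R 1"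
proof -
  let ?c = "\<lambda>t. tensor_lift (*) (tensor_map antipode_map id t) :: 'a H"
  have lin: "linear ?c"
    by (intro linear_comp[OF linear_tensor_lift] linear_tensor_map)
  have c_tens: "?c (y \<otimes> z) = antipode_map y * z" for y z
    by (simp add: tensor_map_tens linear_antipode_map linear_id tensor_lift_tens[OF bilinear_mult])
  have c_Theta: "?c (Theta x t) = shift x (?c t)" for x t
  proof -
    have "(\<lambda>t. ?c (Theta x t)) = (\<lambda>t. shift x (?c t))"
    proof (rule linear_eq_on_tens)
      show "linear (\<lambda>t. ?c (Theta x t))" "linear (\<lambda>t. shift x (?c t))"
        by (auto intro!: linear_comp[OF lin] linear_comp[OF linear_shift] lin linear_Theta)
      show "?c (Theta x (y \<otimes> z)) = shift x (?c (y \<otimes> z))" for y z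
        unfolding Theta_tens
        by (simp add: linear_add[OF lin] linear_sum[OF lin] linear_0[OF lin] c_tens antipode_map_shift
            antipode_shift_def shift_mult algebra_simps sum_distrib_left sum_distrib_right)
    qed
    then show ?thesis by (rule fun_cong)
  qed
  have "(\<lambda>h. ?c (coproduct h)) = (\<lambda>h. counit h *\<^sub>R 1)"
  proof (rule shift_equivariant_hom_ext[of _ _ shift])
    show "algebra_hom (\<lambda>h. ?c (coproduct h))"
      by (intro algebra_hom_comp[OF algebra_hom_tensor_lift_mult]
          algebra_hom_comp[OF algebra_hom_tensor_map] algebra_hom_antipode_map algebra_hom_id
          algebra_hom_coproduct)
  qed (simp_all add: algebra_hom_counit_scale coproduct_shift c_Theta linear_add[OF lin] c_tens
      algebra_homD(2)[OF algebra_hom_antipode_map] linear_cmul[OF linear_shift]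
      derivation_one[OF derivation_shift] del: scaleR_single)
  then show ?thesis by (rule fun_cong)
qed

text \<open>
  Here the equivariance is with respect to \<open>antipode_shift\<close>.  The term \<open>\<theta>\<^sub>j y * S (a\<^sup>j * z)\<close> equals
  \<open>- a\<^sup>j * \<theta>\<^sub>j y * S z\<close>, and supplies the half of the Leibniz rule for \<open>a\<^sup>j \<theta>\<^sub>j\<close> that \<open>y * S (\<theta>\<^sub>0 z)\<close> lacks.
\<close>

lemma antipode_right: "tensor_lift (*) (tensor_map id antipode_map (coproduct h)) = counit h *\<^sub>R 1"
proof -
  let ?c = "\<lambda>t. tensor_lift (*) (tensor_map id antipode_map t) :: 'a H"
  have lin: "linear ?c"
    by (intro linear_comp[OF linear_tensor_lift] linear_tensor_map)
  have c_tens: "?c (y \<otimes> z) = y * antipode_map z" for y z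
    by (simp add: tensor_map_tens linear_antipode_map linear_id tensor_lift_tens[OF bilinear_mult])
  note lin_as = derivationD(1)[OF derivation_antipode_shift]
  have c_Theta: "?c (Theta x t) = antipode_shift x (?c t)" for x t
  proof -
    have "(\<lambda>t. ?c (Theta x t)) = (\<lambda>t. antipode_shift x (?c t))"
    proof (rule linear_eq_on_tens)
      show "linear (\<lambda>t. ?c (Theta x t))" "linear (\<lambda>t. antipode_shift x (?c t))"
        by (auto intro!: linear_comp[OF lin] linear_comp[OF lin_as] lin linear_Theta)
      show "?c (Theta x (y \<otimes> z)) = antipode_shift x (?c (y \<otimes> z))" for y z
      proof -
        let ?z = "antipode_map z"
        have "(\<Sum>j\<in>UNIV. coord j [] * shift (Xj j) (y * ?z))
            = (\<Sum>j\<in>UNIV. shift (Xj j) y * (coord j [] * ?z))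
              + y * (\<Sum>j\<in>UNIV. coord j [] * shift (Xj j) ?z)"
          by (simp add: shift_mult sum_distrib_left sum.distrib distrib_left mult_ac)
        moreover have "?c (\<Sum>j\<in>UNIV. shift (Xj j) y \<otimes> (coord j [] * z))
            = - (\<Sum>j\<in>UNIV. shift (Xj j) y * (coord j [] * ?z))"
          by (simp add: linear_sum[OF lin] c_tens algebra_homD(3)[OF algebra_hom_antipode_map]
              sum_negf)
        ultimately show ?thesis
          by (simp add: Theta_tens linear_add[OF lin] linear_0[OF lin] c_tens antipode_map_shift
              antipode_shift_def shift_mult right_diff_distrib)
      qed
    qed
    then show ?thesis by (rule fun_cong)
  qed
  have "(\<lambda>h. ?c (coproduct h)) = (\<lambda>h. counit h *\<^sub>R 1)"
  proof (rule shift_equivariant_hom_ext[of _ _ antipode_shift])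
    show "algebra_hom (\<lambda>h. ?c (coproduct h))"
      by (intro algebra_hom_comp[OF algebra_hom_tensor_lift_mult]
          algebra_hom_comp[OF algebra_hom_tensor_map] algebra_hom_antipode_map algebra_hom_id
          algebra_hom_coproduct)
  qed (simp_all add: algebra_hom_counit_scale coproduct_shift c_Theta linear_add[OF lin] c_tens
      algebra_homD(2)[OF algebra_hom_antipode_map] linear_cmul[OF lin_as]
      derivation_one[OF derivation_antipode_shift] del: scaleR_single)
  then show ?thesis by (rule fun_cong)
qed

lemma hopf_algebra_coproduct: "hopf_algebra coproduct counit"
  unfolding hopf_algebra_def bialgebra_def coalgebra_def antipode_def
  using linear_coproduct linear_counit algebra_hom_coproduct algebra_hom_counit
    coproduct_coassociative counit_left counit_right
    linear_antipode_map antipode_left antipode_right by blast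

section \<open>The grading\<close>

text \<open>
  \<open>H\<close> and \<open>H \<otimes> H\<close> are both graded by a weight on their basis; treating the weight as a parameter
  covers the two at once.
\<close>

definition weight_comp :: "('b \<Rightarrow> nat) \<Rightarrow> nat \<Rightarrow> ('b \<Rightarrow>\<^sub>0 real) set" where
  "weight_comp w n = span {Poly_Mapping.single b 1 | b. w b = n}"

abbreviation pair_deg :: "'m monomial \<times> 'm monomial \<Rightarrow> nat" where
  "pair_deg \<equiv> \<lambda>(\<mu>, \<nu>). monomial_deg \<mu> + monomial_deg \<nu>"

lemma H_comp_weight_comp: "H_comp = weight_comp monomial_deg"
  by (simp add: H_comp_def weight_comp_def fun_eq_iff)

lemma single_in_weight_comp: "w b = n \<Longrightarrow> Poly_Mapping.single b 1 \<in> weight_comp w n"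
  unfolding weight_comp_def by (intro span_base) auto

lemma subspace_weight_comp: "subspace (weight_comp w n)"
  by (simp add: weight_comp_def)

lemma linear_weight_comp:
  assumes "p \<in> weight_comp w n" "linear f" "subspace W"
    and "\<And>b. w b = n \<Longrightarrow> f (Poly_Mapping.single b 1) \<in> W"
  shows "f p \<in> W"
proof -
  have "subspace {p. f p \<in> W}"
    using linear_subspace_vimage[OF assms(2,3)] by (simp add: vimage_def)
  then have "weight_comp w n \<subseteq> {p. f p \<in> W}"
    unfolding weight_comp_def by (rule span_minimal[rotated]) (use assms in auto)
  with assms(1) show ?thesis by auto
qed

lemma bilinear_weight_comp:
  assumes "p \<in> weight_comp w m" "q \<in> weight_comp w' n" "bilinear B" "subspace W"
    and "\<And>b b'. w b = m \<Longrightarrow> w' b' = n \<Longrightarrow> B (Poly_Mapping.single b 1) (Poly_Mapping.single b' 1) \<in> W"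
  shows "B p q \<in> W"
proof (rule linear_weight_comp[OF assms(1) _ assms(4)])
  show "linear (\<lambda>p. B p q)"
    using assms(3) by (simp add: bilinear_def)
  fix b assume b: "w b = m"
  show "B (Poly_Mapping.single b 1) q \<in> W"
  proof (rule linear_weight_comp[OF assms(2) _ assms(4)])
    show "linear (B (Poly_Mapping.single b 1))"
      using assms(3) by (simp add: bilinear_def)
  qed (rule assms(5)[OF b])
qed

text \<open>
  The coordinate description of the component makes the projections available that are needed for
  directness of the sum.
\<close>

lemma weight_comp_keys: "weight_comp w n = {p. \<forall>b\<in>Poly_Mapping.keys p. w b = n}"
proof (intro equalityI subsetI)
  have "subspace {p :: 'a \<Rightarrow>\<^sub>0 real. \<forall>b. w b \<noteq> n \<longrightarrow> Poly_Mapping.lookup p b = 0}"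
    by (auto intro!: subspaceI simp: lookup_add)
  then have "weight_comp w n \<subseteq> {p. \<forall>b. w b \<noteq> n \<longrightarrow> Poly_Mapping.lookup p b = 0}"
    unfolding weight_comp_def
    by (rule span_minimal[rotated]) (auto simp: lookup_single when_def)
  then show "p \<in> {p. \<forall>b\<in>Poly_Mapping.keys p. w b = n}" if "p \<in> weight_comp w n" for p
    using that by (auto simp: in_keys_iff)
next
  fix p :: "'a \<Rightarrow>\<^sub>0 real" assume "p \<in> {p. \<forall>b\<in>Poly_Mapping.keys p. w b = n}"
  then have "(\<Sum>b\<in>Poly_Mapping.keys p. Poly_Mapping.lookup p b *\<^sub>R Poly_Mapping.single b 1)
      \<in> weight_comp w n"
    by (intro subspace_sum subspace_scale subspace_weight_comp single_in_weight_comp) auto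
  then show "p \<in> weight_comp w n"
    using poly_mapping_eq_sum_single[of p] by simp
qed

lemma direct_sum_weight_comp: "direct_sum_decomposition (weight_comp w)"
  unfolding direct_sum_decomposition_def
proof (intro conjI allI subspace_weight_comp)
  fix p :: "'a \<Rightarrow>\<^sub>0 real"
  define c where "c n = (\<Sum>b\<in>{b\<in>Poly_Mapping.keys p. w b = n}.
    Poly_Mapping.lookup p b *\<^sub>R Poly_Mapping.single b (1::real))" for n
  have lookup_c: "Poly_Mapping.lookup (c n) b = (if w b = n then Poly_Mapping.lookup p b else 0)" for n b
    by (auto simp: c_def lookup_sum lookup_single when_def in_keys_iff)
  \<comment> \<open>Only the component of weight \<open>w b\<close> sees \<open>b\<close>, which forces every decomposition to be \<open>c\<close>.\<close>
  have lookup_sum_comp: "Poly_Mapping.lookup (\<Sum>n | d n \<noteq> 0. d n) b = Poly_Mapping.lookup (d (w b)) b"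
    if d: "\<forall>n. d n \<in> weight_comp w n" and fin: "finite {n. d n \<noteq> 0}" for d b
  proof -
    have "b \<notin> Poly_Mapping.keys (d n)" if "n \<noteq> w b" for n
      using d that unfolding weight_comp_keys by auto
    then have "Poly_Mapping.lookup (d n) b = 0" if "n \<noteq> w b" for n
      using that by (simp add: in_keys_iff)
    then have "Poly_Mapping.lookup (\<Sum>n | d n \<noteq> 0. d n) b
        = (\<Sum>n | d n \<noteq> 0. if n = w b then Poly_Mapping.lookup (d (w b)) b else 0)"
      unfolding lookup_sum by (intro sum.cong) auto
    also have "\<dots> = Poly_Mapping.lookup (d (w b)) b"
      using fin by auto
    finally show ?thesis .
  qed
  have c_comp: "\<forall>n. c n \<in> weight_comp w n"
    by (auto simp: weight_comp_keys in_keys_iff lookup_c split: if_splits)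
  have "{n. c n \<noteq> 0} \<subseteq> w ` Poly_Mapping.keys p"
    by (auto simp: c_def intro!: sum.neutral)
  then have c_fin: "finite {n. c n \<noteq> 0}"
    by (rule finite_subset) simp
  show "\<exists>!c. (\<forall>n. c n \<in> weight_comp w n) \<and> finite {n. c n \<noteq> 0} \<and> p = (\<Sum>n | c n \<noteq> 0. c n)"
  proof (rule ex1I[of _ c])
    show "(\<forall>n. c n \<in> weight_comp w n) \<and> finite {n. c n \<noteq> 0} \<and> p = (\<Sum>n | c n \<noteq> 0. c n)"
    proof (intro conjI c_comp c_fin poly_mapping_eqI)
      show "Poly_Mapping.lookup p b = Poly_Mapping.lookup (\<Sum>n | c n \<noteq> 0. c n) b" for b
        unfolding lookup_sum_comp[OF c_comp c_fin] by (simp add: lookup_c)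
    qed
    fix d assume d: "(\<forall>n. d n \<in> weight_comp w n) \<and> finite {n. d n \<noteq> 0} \<and> p = (\<Sum>n | d n \<noteq> 0. d n)"
    show "d = c"
    proof (intro ext poly_mapping_eqI)
      fix n b
      show "Poly_Mapping.lookup (d n) b = Poly_Mapping.lookup (c n) b"
      proof (cases "w b = n")
        case True
        have "Poly_Mapping.lookup p b = Poly_Mapping.lookup (d (w b)) b"
          using d lookup_sum_comp[of d b] by metis
        with True show ?thesis by (simp add: lookup_c)
      next
        case False
        then have "b \<notin> Poly_Mapping.keys (d n)"
          using d unfolding weight_comp_keys by auto
        then show ?thesis using False by (simp add: lookup_c in_keys_iff)
      qed
    qed
  qed
qed

lemma weight_comp_mult:
  fixes w :: "'b::monoid_add \<Rightarrow> nat"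
  assumes "\<And>a b. w (a + b) = w a + w b" "p \<in> weight_comp w m" "q \<in> weight_comp w n"
  shows "p * q \<in> weight_comp w (m + n)"
  by (rule bilinear_weight_comp[OF assms(2,3) bilinear_mult subspace_weight_comp])
    (auto simp: mult_single assms(1) intro!: single_in_weight_comp)

lemmas H_comp_mult = weight_comp_mult[of monomial_deg, OF monomial_deg_add, folded H_comp_weight_comp]

lemma HH_comp_mult:
  "s \<in> weight_comp pair_deg m \<Longrightarrow> t \<in> weight_comp pair_deg n \<Longrightarrow> s * t \<in> weight_comp pair_deg (m + n)"
  by (rule weight_comp_mult) (auto simp: monomial_deg_add)

lemma tens_in_HH_comp:
  "p \<in> H_comp m \<Longrightarrow> q \<in> H_comp n \<Longrightarrow> p \<otimes> q \<in> weight_comp pair_deg (m + n)"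
  unfolding H_comp_weight_comp
  by (rule bilinear_weight_comp[OF _ _ bilinear_tens subspace_weight_comp])
    (auto intro!: single_in_weight_comp)

lemma coord_in_H_comp: "coord l \<eta> \<in> H_comp (1 + word_norm \<eta>)"
  unfolding H_comp_weight_comp coord_def gen_def
  by (intro single_in_weight_comp monomial_deg_single)

lemma monomial_deg_single_add:
  "monomial_deg (Poly_Mapping.single (l, \<eta>) 1 + \<mu>) = 1 + word_norm \<eta> + monomial_deg \<mu>"
  by (simp only: monomial_deg_add monomial_deg_single)

lemma word_norm_append: "word_norm (\<eta> @ \<xi>) = word_norm \<eta> + word_norm \<xi>"
  by (simp add: word_norm_def)

lemma one_in_H_comp: "1 \<in> H_comp 0"
  unfolding H_comp_weight_comp single_one[symmetric]
  by (rule single_in_weight_comp) (simp add: monomial_deg_def)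

text \<open>
  By the Leibniz rule a shift lengthens one factor of a monomial at a time, by the same letter.
\<close>

lemma shift_in_H_comp:
  assumes "p \<in> H_comp n"
  shows "shift x p \<in> H_comp (n + word_norm [x])"
proof -
  have mono: "shift x (Poly_Mapping.single \<mu> 1) \<in> H_comp (monomial_deg \<mu> + word_norm [x])" for \<mu>
  proof (induction \<mu> rule: monomial_induct)
    case zero
    show ?case
      by (simp add: derivation_one[OF derivation_shift] H_comp_def span_zero)
  next
    case (add v \<mu>)
    obtain l \<eta> where v: "v = (l, \<eta>)" by (cases v)
    have "gen v \<in> H_comp (1 + word_norm \<eta>)"
      using coord_in_H_comp[of l \<eta>] by (simp add: coord_def v)
    moreover have "shift x (gen v) \<in> H_comp (1 + word_norm \<eta> + word_norm [x])"
      using coord_in_H_comp[of l "\<eta> @ [x]"] shift_coord[of x l \<eta>]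
      by (simp add: coord_def v word_norm_append)
    moreover have "Poly_Mapping.single \<mu> 1 \<in> H_comp (monomial_deg \<mu>)"
      by (simp add: H_comp_weight_comp single_in_weight_comp)
    ultimately have "shift x (gen v) * Poly_Mapping.single \<mu> 1
        \<in> H_comp (1 + word_norm \<eta> + word_norm [x] + monomial_deg \<mu>)"
      "gen v * shift x (Poly_Mapping.single \<mu> 1)
        \<in> H_comp (1 + word_norm \<eta> + (monomial_deg \<mu> + word_norm [x]))"
      using add by (blast intro: H_comp_mult)+
    then show ?case
      unfolding gen_mult_single[symmetric] shift_mult
      unfolding v monomial_deg_single_add H_comp_def by (simp add: add_ac span_add)
  qed
  show ?thesis
    using assms unfolding H_comp_weight_comp
    by (rule linear_weight_comp[OF _ linear_shift subspace_weight_comp])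
      (use mono in \<open>auto simp: H_comp_weight_comp\<close>)
qed

text \<open>
  For \<open>x = X0\<close>, of weight \<open>2\<close>, the summand \<open>\<theta>\<^sub>j \<otimes> a\<^sup>j\<close> raises the left degree by \<open>1\<close> (the weight of \<open>Xj j\<close>)
  and the right degree by \<open>1\<close> (the degree of \<open>coord j []\<close>).
\<close>

lemma Theta_in_HH_comp:
  assumes "t \<in> weight_comp pair_deg n"
  shows "Theta x t \<in> weight_comp pair_deg (n + word_norm [x])"
proof (rule linear_weight_comp[OF assms linear_Theta subspace_weight_comp])
  fix b :: "'a monomial \<times> 'a monomial" assume n: "pair_deg b = n"
  obtain \<mu> \<nu> where b: "b = (\<mu>, \<nu>)" by (cases b)
  let ?y = "Poly_Mapping.single \<mu> 1 :: 'a H" and ?z = "Poly_Mapping.single \<nu> 1 :: 'a H"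
  have y: "?y \<in> H_comp (monomial_deg \<mu>)" and z: "?z \<in> H_comp (monomial_deg \<nu>)"
    by (simp_all add: H_comp_weight_comp single_in_weight_comp)
  have "shift x ?y \<otimes> ?z \<in> weight_comp pair_deg (n + word_norm [x])"
    using tens_in_HH_comp[OF shift_in_H_comp[OF y] z, of x] n by (auto simp: b add_ac)
  moreover have "?y \<otimes> shift x ?z \<in> weight_comp pair_deg (n + word_norm [x])"
    using tens_in_HH_comp[OF y shift_in_H_comp[OF z], of x] n by (auto simp: b add_ac)
  moreover have "shift (Xj j) ?y \<otimes> (coord j [] * ?z) \<in> weight_comp pair_deg (n + word_norm [X0])" for j
    using tens_in_HH_comp[OF shift_in_H_comp[OF y, of "Xj j"] H_comp_mult[OF coord_in_H_comp[of j "[]"] z]] n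
    by (simp add: b word_norm_def)
  ultimately have "Theta x (?y \<otimes> ?z) \<in> weight_comp pair_deg (n + word_norm [x])"
    unfolding Theta_tens
    by (auto intro!: subspace_add subspace_sum subspace_weight_comp subspace_0)
  then show "Theta x (Poly_Mapping.single b 1) \<in> weight_comp pair_deg (n + word_norm [x])"
    by (simp add: b)
qed

lemma coproduct_coord_in_HH_comp: "coproduct (coord l \<eta>) \<in> weight_comp pair_deg (1 + word_norm \<eta>)"
proof (induction \<eta> rule: rev_induct)
  case Nil
  show ?case
    using tens_in_HH_comp[OF coord_in_H_comp[of l "[]"] one_in_H_comp]
      tens_in_HH_comp[OF one_in_H_comp coord_in_H_comp[of l "[]"]]
    by (auto intro!: subspace_add subspace_weight_comp)
next
  case (snoc x \<eta>)
  then show ?case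
    using Theta_in_HH_comp[OF snoc, of x] coproduct_shift[of x "coord l \<eta>"]
    by (simp add: word_norm_append add_ac)
qed

lemma coproduct_in_HH_comp:
  assumes "p \<in> H_comp n"
  shows "coproduct p \<in> weight_comp pair_deg n"
proof -
  have mono: "coproduct (Poly_Mapping.single \<mu> 1) \<in> weight_comp pair_deg (monomial_deg \<mu>)" for \<mu> :: "'a monomial"
  proof (induction \<mu> rule: monomial_induct)
    case zero
    show ?case
      using tens_in_HH_comp[OF one_in_H_comp one_in_H_comp]
      by (simp add: algebra_homD(2)[OF algebra_hom_coproduct] one_tens_one monomial_deg_def)
  next
    case (add v \<mu>)
    obtain l \<eta> where v: "v = (l, \<eta>)" by (cases v)
    have "coproduct (gen v) * coproduct (Poly_Mapping.single \<mu> 1)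
        \<in> weight_comp pair_deg (1 + word_norm \<eta> + monomial_deg \<mu>)"
      using coproduct_coord_in_HH_comp[of l \<eta>] add by (intro HH_comp_mult) (auto simp: coord_def v)
    then show ?case
      unfolding gen_mult_single[symmetric] algebra_homD(3)[OF algebra_hom_coproduct]
      unfolding v monomial_deg_single_add .
  qed
  show ?thesis
    using assms unfolding H_comp_weight_comp
    by (rule linear_weight_comp[OF _ linear_coproduct subspace_weight_comp]) (use mono in auto)
qed

lemma hopf_grading_coproduct: "hopf_grading H_comp coproduct"
  unfolding hopf_grading_def
proof (intro conjI allI ballI)
  show "direct_sum_decomposition H_comp"
    unfolding H_comp_weight_comp by (rule direct_sum_weight_comp)
  show "x * y \<in> H_comp (p + q)" if "x \<in> H_comp p" "y \<in> H_comp q" for p q and x y :: "'a H"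
    using that by (rule H_comp_mult)
  fix n and x :: "'a H" assume "x \<in> H_comp n"
  then have "coproduct x \<in> weight_comp pair_deg n"
    by (rule coproduct_in_HH_comp)
  then show "coproduct x
      \<in> span (\<Union>(p, q)\<in>{(p, q). p + q = n}. tensor_subspace (H_comp p) (H_comp q))"
  proof (rule linear_weight_comp[where f = "\<lambda>t. t"])
    fix b :: "'a monomial \<times> 'a monomial" assume n: "pair_deg b = n"
    obtain \<mu> \<nu> where b: "b = (\<mu>, \<nu>)" by (cases b)
    have "Poly_Mapping.single \<mu> 1 \<otimes> Poly_Mapping.single \<nu> 1
        \<in> tensor_subspace (H_comp (monomial_deg \<mu>)) (H_comp (monomial_deg \<nu>))"
      unfolding tensor_subspace_def H_comp_weight_comp
      by (rule span_base) (blast intro: single_in_weight_comp)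
    then show "Poly_Mapping.single b 1
        \<in> span (\<Union>(p, q)\<in>{(p, q). p + q = n}. tensor_subspace (H_comp p) (H_comp q))"
      using n by (intro span_base UN_I[of "(monomial_deg \<mu>, monomial_deg \<nu>)"]) (simp_all add: b)
  qed (simp_all add: linear_ident)
qed

lemma monomial_deg_eq_0_iff: "monomial_deg \<mu> = 0 \<longleftrightarrow> \<mu> = 0"
proof
  show "monomial_deg \<mu> = 0 \<Longrightarrow> \<mu> = 0"
  proof (induction \<mu> rule: monomial_induct)
    case (add v \<mu>)
    then show ?case
      using monomial_deg_single_add[of "fst v" "snd v" \<mu>] by simp
  qed simp
qed (simp add: monomial_deg_def)

lemma connected_grading_H_comp: "connected_grading H_comp"
proof -
  have "H_comp 0 = span {1 :: 'a H}"
    unfolding H_comp_def monomial_deg_eq_0_iff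
    by (rule arg_cong[of _ _ span]) (auto simp flip: single_one)
  also have "\<dots> = {c *\<^sub>R 1 | c. True}"
    unfolding span_singleton by blast
  finally show ?thesis
    unfolding connected_grading_def .
qed

section \<open>Linearity in the left factor and noncocommutativity\<close>

text \<open>
  The operators \<open>Theta x\<close> act on the left factor only by shifts, which annihilate \<open>1\<close> and map the span
  of the generators into itself; all products are formed in the right factor.
\<close>

lemma coproduct_coord_left_linear:
  "coproduct (coord l \<eta>) \<in> tensor_subspace {c *\<^sub>R 1 + v | c v. v \<in> coord_space} UNIV"
proof -
  let ?L = "{c *\<^sub>R 1 + v | c v. v \<in> coord_space} :: 'a H set"
  let ?W = "tensor_subspace ?L UNIV"
  have W: "subspace ?W"
    by (simp add: tensor_subspace_def)
  have tens: "y \<otimes> z \<in> ?W" if "y \<in> ?L" for y z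
    unfolding tensor_subspace_def using that by (intro span_base) blast
  have coord_L: "y \<in> ?L" if "y \<in> coord_space" for y
    using that by (auto intro!: exI[of _ 0] exI[of _ y])
  have "(1 :: 'a H) = 1 *\<^sub>R 1 + 0" "(0 :: 'a H) \<in> coord_space"
    by (simp_all add: coord_space_def span_zero)
  then have one_L: "1 \<in> ?L" by blast
  have shift_V: "shift x v \<in> coord_space" if "v \<in> coord_space" for x and v :: "'a H"
  proof -
    have "subspace {v :: 'a H. shift x v \<in> coord_space}"
      using linear_subspace_vimage[OF linear_shift, of coord_space x]
      by (simp add: vimage_def coord_space_def)
    then have "coord_space \<subseteq> {v :: 'a H. shift x v \<in> coord_space}"
      unfolding coord_space_def by (rule span_minimal[rotated]) (clarsimp, rule span_base, blast)
    with that show ?thesis by auto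
  qed
  have shift_L: "shift x y \<in> ?L" if "y \<in> ?L" for x y
  proof -
    from that obtain c v where "y = c *\<^sub>R 1 + v" "v \<in> coord_space" by auto
    then have "shift x y \<in> coord_space"
      using shift_V by (simp add: linear_add[OF linear_shift] linear_cmul[OF linear_shift]
          derivation_one[OF derivation_shift] del: scaleR_single)
    then show ?thesis by (rule coord_L)
  qed
  have Theta_W: "Theta x t \<in> ?W" if "t \<in> ?W" for x t
  proof -
    have *: "Theta x (y \<otimes> z) \<in> ?W" if "y \<in> ?L" for y z
    proof -
      have "shift x y \<otimes> z + y \<otimes> shift x z \<in> ?W"
        by (intro subspace_add[OF W] tens shift_L that)
      moreover have "(\<Sum>j\<in>UNIV. shift (Xj j) y \<otimes> (coord j [] * z)) \<in> ?W"
        by (intro subspace_sum[OF W] tens shift_L that)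
      ultimately show ?thesis
        unfolding Theta_tens
        by (cases "x = X0") (simp_all only: simp_thms if_True if_False add_0_right subspace_add[OF W])
    qed
    have sub: "subspace {t. Theta x t \<in> ?W}"
      using linear_subspace_vimage[OF linear_Theta W, of x] by (simp only: vimage_def)
    have "?W \<subseteq> {t. Theta x t \<in> ?W}"
      unfolding tensor_subspace_def[of ?L]
      by (rule span_minimal[OF _ sub[unfolded tensor_subspace_def[of ?L]]])
        (use *[unfolded tensor_subspace_def[of ?L]] in blast)
    with that show ?thesis by auto
  qed
  show ?thesis
  proof (induction \<eta> rule: rev_induct)
    case Nil
    have "coord l [] \<in> ?L"
      by (rule coord_L) (auto simp: coord_space_def intro!: span_base)
    then show ?case
      unfolding coproduct_coord_Nil by (intro subspace_add[OF W] tens one_L)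
  next
    case (snoc x \<eta>)
    then show ?case
      using Theta_W[OF snoc, of x] coproduct_shift[of x "coord l \<eta>"] by simp
  qed
qed

lemma lookup_tens: "Poly_Mapping.lookup (x \<otimes> y) (a, b) = Poly_Mapping.lookup x a * Poly_Mapping.lookup y b"
  by (simp add: tens.rep_eq)

lemma lookup_coord_single:
  "Poly_Mapping.lookup (coord i \<eta>) (Poly_Mapping.single v 1) = (if v = (i, \<eta>) then 1 else 0)"
proof -
  have "Poly_Mapping.single (i, \<eta>) (1::nat) = Poly_Mapping.single v 1 \<longleftrightarrow> v = (i, \<eta>)"
    by (metis lookup_single_eq lookup_single_not_eq one_neq_zero)
  then show ?thesis
    unfolding coord_def gen_def lookup_single when_def by simp
qed

lemma lookup_one_single: "Poly_Mapping.lookup (1 :: 'm H) (Poly_Mapping.single v 1) = 0"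
proof -
  have "Poly_Mapping.single v (1::nat) \<noteq> 0"
    by (metis lookup_single_eq lookup_zero one_neq_zero)
  then show ?thesis
    by (simp add: lookup_one when_def)
qed

text \<open>
  The witness is \<open>coord l [X0]\<close>, the lowest-degree generator on which the twist in \<open>Theta X0\<close> is seen: its
  coproduct is primitive up to \<open>\<Sum>j. coord l [Xj j] \<otimes> coord j []\<close>, whose \<open>j = l\<close> term singles out a
  basis element that the flipped sum misses.
\<close>

lemma coproduct_not_cocommutative: "\<not> cocommutative (coproduct :: 'm::finite H \<Rightarrow> 'm HH)"
proof
  assume "cocommutative (coproduct :: 'm H \<Rightarrow> 'm HH)"
  fix l :: 'm
  let ?b = "(Poly_Mapping.single (l, [Xj l]) 1, Poly_Mapping.single (l, []) 1)
    :: 'm monomial \<times> 'm monomial"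
  let ?t = "coproduct (coord l [X0]) :: 'm HH"
  have \<Delta>: "?t = coord l [X0] \<otimes> 1 + 1 \<otimes> coord l [X0] + (\<Sum>j\<in>UNIV. coord l [Xj j] \<otimes> coord j [])"
    using coproduct_shift[of X0 "coord l []"]
    by (simp add: linear_add[OF linear_Theta] Theta_tens derivation_one[OF derivation_shift])
  have lin: "linear (tensor_flip :: 'm HH \<Rightarrow> 'm HH)"
    unfolding tensor_flip_def by (rule linear_tensor_lift)
  have flip: "tensor_flip ?t
      = 1 \<otimes> coord l [X0] + coord l [X0] \<otimes> 1 + (\<Sum>j\<in>UNIV. coord j [] \<otimes> coord l [Xj j])"
    by (simp add: \<Delta> linear_add[OF lin] linear_sum[OF lin] tensor_flip_tens)
  have "Poly_Mapping.lookup ?t ?b = 1"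
    unfolding \<Delta> lookup_add lookup_sum lookup_tens lookup_coord_single lookup_one_single
    by (simp add: if_distrib[of "\<lambda>c. c * _"] cong: if_cong)
  moreover have "Poly_Mapping.lookup (tensor_flip ?t) ?b = 0"
    unfolding flip lookup_add lookup_sum lookup_tens lookup_coord_single lookup_one_single
    by simp
  moreover have "tensor_flip ?t = ?t"
    using \<open>cocommutative coproduct\<close> by (simp add: cocommutative_def)
  ultimately show False by simp
qed

theorem theorem7:
  shows "(\<forall>(l::'m::finite) \<eta>. coproduct (coord l \<eta>) \<in>
      tensor_subspace {c *\<^sub>R 1 + v | c v. v \<in> coord_space} UNIV) \<and>
    hopf_algebra (coproduct :: 'm H \<Rightarrow> 'm HH) counit \<and>
    hopf_grading H_comp (coproduct :: 'm H \<Rightarrow> 'm HH) \<and>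
    connected_grading (H_comp :: nat \<Rightarrow> 'm H set) \<and>
    (\<forall>x y :: 'm H. x * y = y * x) \<and>
    \<not> cocommutative (coproduct :: 'm H \<Rightarrow> 'm HH)"
  using coproduct_coord_left_linear hopf_algebra_coproduct hopf_grading_coproduct
    connected_grading_H_comp coproduct_not_cocommutative
  by (auto simp: mult.commute)

end
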